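(* Fix integers $1 \le M \le N < \infty$ and real $\alpha, \eta, \theta \ge 0$, not all zero. Let $(\omega_{i,j})_{1\le i\le M,\,1\le j\le N}$ be independent random variables with $\omega_{i,j} \sim \mathrm{Pow}\left(\alpha + \eta(i-\tfrac12) + \theta(j-\tfrac12)\right)$. Define $$L_1 = \min_{\pi}\prod_{(i,j)\in\pi}\omega_{i,j}, \qquad L_2 = \min_{\varpi}\prod_{(i,j)\in\varpi}\omega_{i,j},$$ where: - $\pi$ ranges over lattice paths from $(1,1)$ to $(M,N)$ with steps $(i,j)\to(i+1,j)$ or $(i,j)\to(i,j+1)$; - $\varpi$ ranges over lattice paths from $(M,1)$ to $(1,N)$ with steps $(i,j)\to(i-1,j)$ or $(i,j)\to(i,j+1)$. Let $\vec{x} = (0 < x_1 < \dots < x_M < 1)$ be a random $M$-point configuration with density $$\mathbb{P}(\vec{x} \in d\vec{x}) \propto \prod_{1\le i<j\le M}\left(x_j^\eta - x_i^\eta\right)\left(x_j^\theta - x_i^\theta\right)\prod_{i=1}^{M} x_i^{\alpha + \frac{\eta+\theta}{2} - 1}\left(1 - x_i^\theta\right)^{N-M}.$$ Then $L_1$, $L_2$ and $x_1$ have the same distribution.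
   Context: $Y \sim \mathrm{Pow}(\beta)$ for $\beta > 0$ means $Y$ has density $\beta x^{\beta-1}$ on $[0,1]$.
   Formalization: When η = 0 or θ = 0 the stated density can vanish identically; it is then read as the limit η→0+ or θ→0+: x_j^η − x_i^η (resp. x_j^θ − x_i^θ) becomes ln x_j − ln x_i, and 1 − x_i^θ becomes −ln x_i. *)

theory Defs
  imports "HOL-Probability.Probability"
begin

text \<open>The distribution \<open>Pow(\<beta>)\<close>.  Isabelle's \<open>0 powr a = 0\<close> only affects the
  density on the null set \<open>{0}\<close>.\<close>

definition pow_density :: "real \<Rightarrow> real \<Rightarrow> ennreal" where
  "pow_density \<beta> x = ennreal (\<beta> * x powr (\<beta> - 1)) * indicator {0..1} x"

type_synonym cell = "nat \<times> nat"

definition lattice_paths :: "(cell \<Rightarrow> cell \<Rightarrow> bool) \<Rightarrow> cell \<Rightarrow> cell \<Rightarrow> cell list set" where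
  "lattice_paths step a b = {p. p \<noteq> [] \<and> hd p = a \<and> last p = b \<and> successively step p}"

fun step_up :: "cell \<Rightarrow> cell \<Rightarrow> bool" where
  "step_up (i, j) (i', j') \<longleftrightarrow> (i' = i + 1 \<and> j' = j) \<or> (i' = i \<and> j' = j + 1)"

fun step_down :: "cell \<Rightarrow> cell \<Rightarrow> bool" where
  "step_down (i, j) (i', j') \<longleftrightarrow> (i = i' + 1 \<and> j' = j) \<or> (i' = i \<and> j' = j + 1)"

text \<open>The paths counted below are automatically confined to \<open>{1..M} \<times> {1..N}\<close>, because
  each coordinate is monotone along a path.  For \<open>1 \<le> M\<close> and \<open>1 \<le> N\<close> the minima range over
  finite nonempty sets (see the lemmas below).\<close>

definition L1 :: "nat \<Rightarrow> nat \<Rightarrow> (cell \<Rightarrow> real) \<Rightarrow> real" where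
  "L1 M N w = Min ((\<lambda>p. \<Prod>c\<in>set p. w c) ` lattice_paths step_up (1, 1) (M, N))"

definition L2 :: "nat \<Rightarrow> nat \<Rightarrow> (cell \<Rightarrow> real) \<Rightarrow> real" where
  "L2 M N w = Min ((\<lambda>p. \<Prod>c\<in>set p. w c) ` lattice_paths step_down (M, 1) (1, N))"

lemma step_up_path_bounds:
  assumes "p \<noteq> []" "successively step_up p"
  shows "set p \<subseteq> {fst (hd p)..fst (last p)} \<times> {snd (hd p)..snd (last p)} \<and>
    fst (last p) + snd (last p) + 1 = fst (hd p) + snd (hd p) + length p"
  using assms
proof (induction p rule: induct_list012)
  case (3 c d p)
  let ?q = "d # p"
  have step: "step_up c d" and IH: "set ?q \<subseteq> {fst d..fst (last ?q)} \<times> {snd d..snd (last ?q)}"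
    and len: "fst (last ?q) + snd (last ?q) + 1 = fst d + snd d + length ?q"
    using 3 by auto
  have "d \<in> set ?q" by simp
  with IH have d: "d \<in> {fst d..fst (last ?q)} \<times> {snd d..snd (last ?q)}" by blast
  have "set ?q \<subseteq> {fst c..fst (last ?q)} \<times> {snd c..snd (last ?q)}"
    by (rule order_trans[OF IH], rule Sigma_mono) (use step in \<open>cases c; cases d; auto\<close>)+
  moreover have "c \<in> {fst c..fst (last ?q)} \<times> {snd c..snd (last ?q)}"
    using step d by (cases c; cases d) auto
  moreover have "fst (last ?q) + snd (last ?q) + 1 = fst c + snd c + Suc (length ?q)"
    using step len by (cases c; cases d) auto
  ultimately show ?case by simp
qed auto

lemma step_down_path_bounds:
  assumes "p \<noteq> []" "successively step_down p"
  shows "set p \<subseteq> {fst (last p)..fst (hd p)} \<times> {snd (hd p)..snd (last p)} \<and>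
    snd (last p) + fst (hd p) + 1 = fst (last p) + snd (hd p) + length p"
  using assms
proof (induction p rule: induct_list012)
  case (3 c d p)
  let ?q = "d # p"
  have step: "step_down c d" and IH: "set ?q \<subseteq> {fst (last ?q)..fst d} \<times> {snd d..snd (last ?q)}"
    and len: "snd (last ?q) + fst d + 1 = fst (last ?q) + snd d + length ?q"
    using 3 by auto
  have "d \<in> set ?q" by simp
  with IH have d: "d \<in> {fst (last ?q)..fst d} \<times> {snd d..snd (last ?q)}" by blast
  have "set ?q \<subseteq> {fst (last ?q)..fst c} \<times> {snd c..snd (last ?q)}"
    by (rule order_trans[OF IH], rule Sigma_mono) (use step in \<open>cases c; cases d; auto\<close>)+
  moreover have "c \<in> {fst (last ?q)..fst c} \<times> {snd c..snd (last ?q)}"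
    using step d by (cases c; cases d) auto
  moreover have "snd (last ?q) + fst c + 1 = fst (last ?q) + snd c + Suc (length ?q)"
    using step len by (cases c; cases d) auto
  ultimately show ?case by simp
qed auto

lemma finite_lattice_paths:
  "finite (lattice_paths step_up (1, 1) (M, N))"
  "finite (lattice_paths step_down (M, 1) (1, N))"
proof -
  let ?F = "{p. set p \<subseteq> {1..M} \<times> {1..N} \<and> length p \<le> M + N}"
  have "finite ?F" by (rule finite_lists_length_le) simp
  moreover have "lattice_paths step_up (1, 1) (M, N) \<subseteq> ?F"
  proof
    fix p assume "p \<in> lattice_paths step_up (1, 1) (M, N)"
    then show "p \<in> ?F" using step_up_path_bounds[of p] by (simp add: lattice_paths_def)
  qed
  moreover have "lattice_paths step_down (M, 1) (1, N) \<subseteq> ?F"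
  proof
    fix p assume "p \<in> lattice_paths step_down (M, 1) (1, N)"
    then show "p \<in> ?F" using step_down_path_bounds[of p] by (simp add: lattice_paths_def)
  qed
  ultimately show "finite (lattice_paths step_up (1, 1) (M, N))"
    "finite (lattice_paths step_down (M, 1) (1, N))"
    by (auto intro: finite_subset)
qed

lemma lattice_paths_snoc:
  assumes "lattice_paths step a b \<noteq> {}" "step b c"
  shows "lattice_paths step a c \<noteq> {}"
proof -
  obtain p where "p \<in> lattice_paths step a b" using assms(1) by blast
  then have "p @ [c] \<in> lattice_paths step a c"
    using assms(2) by (auto simp: lattice_paths_def successively_append_iff)
  then show ?thesis by blast
qed

lemma lattice_paths_nonempty:
  assumes "1 \<le> M" "1 \<le> N"
  shows "lattice_paths step_up (1, 1) (M, N) \<noteq> {}"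
    and "lattice_paths step_down (M, 1) (1, N) \<noteq> {}"
proof -
  have single: "lattice_paths step a a \<noteq> {}" for step a
  proof -
    have "[a] \<in> lattice_paths step a a" by (simp add: lattice_paths_def)
    then show ?thesis by blast
  qed
  have up: "lattice_paths step_up (1, 1) (m, 1) \<noteq> {}" if "1 \<le> m" for m
    using that
  proof (induction m rule: dec_induct)
    case (step m)
    show ?case by (rule lattice_paths_snoc[OF step.IH]) simp
  qed (rule single)
  show "lattice_paths step_up (1, 1) (M, N) \<noteq> {}"
    using assms(2)
  proof (induction N rule: dec_induct)
    case (step n)
    show ?case by (rule lattice_paths_snoc[OF step.IH]) simp
  qed (rule up[OF assms(1)])
  have down: "lattice_paths step_down (M, 1) (m, 1) \<noteq> {}" if "m \<le> M" for m
    using that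
  proof (induction m rule: inc_induct)
    case (step m)
    show ?case by (rule lattice_paths_snoc[OF step.IH]) simp
  qed (rule single)
  show "lattice_paths step_down (M, 1) (1, N) \<noteq> {}"
    using assms(2)
  proof (induction N rule: dec_induct)
    case (step n)
    show ?case by (rule lattice_paths_snoc[OF step.IH]) simp
  qed (rule down[OF assms(1)])
qed

text \<open>For \<open>s = 0\<close> the difference \<open>b\<^sup>s - a\<^sup>s\<close> vanishes identically, and a density
  proportional to a product containing such factors is understood as the limit
  \<open>s \<rightarrow> 0+\<close>.  After absorbing a power of \<open>s\<close> into the normalising constant, this replaces
  \<open>b\<^sup>s - a\<^sup>s\<close> by \<open>ln b - ln a\<close> (see \<open>power_difference_limit\<close>).\<close>

definition power_difference :: "real \<Rightarrow> real \<Rightarrow> real \<Rightarrow> real" where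
  "power_difference s a b = (if s = 0 then ln b - ln a else b powr s - a powr s)"

lemma power_difference_limit:
  assumes "0 < a" "0 < b"
  shows "((\<lambda>s. power_difference s a b / s) \<longlongrightarrow> power_difference 0 a b) (at_right 0)"
proof -
  have "((\<lambda>s. b powr s - a powr s) has_real_derivative ln b - ln a) (at 0)"
    using assms by (auto intro!: derivative_eq_intros)
  then have "((\<lambda>s. (b powr s - a powr s) / s) \<longlongrightarrow> ln b - ln a) (at 0)"
    using assms by (simp add: has_field_derivative_iff)
  then have "((\<lambda>s. (b powr s - a powr s) / s) \<longlongrightarrow> ln b - ln a) (at_right 0)"
    by (rule tendsto_mono[rotated]) (simp add: at_le)
  moreover have "\<forall>\<^sub>F s in at_right 0.
      (b powr s - a powr s) / s = power_difference s a b / s"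
    using eventually_at_right_less[of "0::real"]
    by eventually_elim (simp add: power_difference_def)
  ultimately show ?thesis
    by (simp add: power_difference_def Lim_transform_eventually)
qed

text \<open>Configurations \<open>0 < x\<^sub>1 < \<dots> < x\<^sub>M < 1\<close>, as extensional functions on \<open>{1..M}\<close>.\<close>

definition ordered_configurations :: "nat \<Rightarrow> (nat \<Rightarrow> real) set" where
  "ordered_configurations M =
    {x \<in> {1..M} \<rightarrow>\<^sub>E {0<..<1}. strict_mono_on {1..M} x}"

text \<open>The factor \<open>1 - x\<^sub>i\<^sup>\<theta>\<close> is \<open>power_difference \<theta> (x i) 1\<close>, read as \<open>- ln (x i)\<close>
  when \<open>\<theta> = 0\<close>.\<close>

definition ensemble_weight ::
    "nat \<Rightarrow> nat \<Rightarrow> real \<Rightarrow> real \<Rightarrow> real \<Rightarrow> (nat \<Rightarrow> real) \<Rightarrow> real" where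
  "ensemble_weight M N \<alpha> \<eta> \<theta> x =
    (\<Prod>j\<in>{1..M}. \<Prod>i\<in>{1..<j}.
        power_difference \<eta> (x i) (x j) * power_difference \<theta> (x i) (x j)) *
    (\<Prod>i\<in>{1..M}. x i powr (\<alpha> + (\<eta> + \<theta>) / 2 - 1) * power_difference \<theta> (x i) 1 ^ (N - M))"

definition ensemble_density ::
    "nat \<Rightarrow> nat \<Rightarrow> real \<Rightarrow> real \<Rightarrow> real \<Rightarrow> (nat \<Rightarrow> real) \<Rightarrow> ennreal" where
  "ensemble_density M N \<alpha> \<eta> \<theta> x =
    ennreal (ensemble_weight M N \<alpha> \<eta> \<theta> x) * indicator (ordered_configurations M) x"

text \<open>The law of the random configuration.  Finiteness of the normalising integral is not
  assumed: if the integral were infinite, this would be the zero measure.\<close>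

definition ensemble :: "nat \<Rightarrow> nat \<Rightarrow> real \<Rightarrow> real \<Rightarrow> real \<Rightarrow> (nat \<Rightarrow> real) measure" where
  "ensemble M N \<alpha> \<eta> \<theta> =
    density (Pi\<^sub>M {1..M} (\<lambda>_. lborel))
      (\<lambda>x. ensemble_density M N \<alpha> \<eta> \<theta> x /
        (\<integral>\<^sup>+ y. ensemble_density M N \<alpha> \<eta> \<theta> y \<partial>(Pi\<^sub>M {1..M} (\<lambda>_. lborel))))"

end

theory Submission
  imports Defs "Jordan_Normal_Form.Determinant"
begin

text \<open>
  In the coordinates \<open>- ln \<omega>\<close> the weights are exponential with rates of the form \<open>a\<^sub>i + b\<^sub>j\<close>, and \<open>- ln L\<^sub>1\<close>
  is a last passage time.  Let \<open>G(i, n)\<close> be the last passage time to \<open>(i, n)\<close>.  The joint distribution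
  function of \<open>G(1, n), \<dots>, G(k, n), G(k + 1, n - 1), \<dots>, G(M, n - 1)\<close> is a multiple of a determinant whose
  \<open>j\<close>-th column depends on the \<open>j\<close>-th argument only.  Passing from \<open>k - 1\<close> to \<open>k\<close> adds one exponential
  variable, hence amounts to a first-order linear differential equation in the \<open>k\<close>-th argument; the maximum in
  the recursion for \<open>G\<close> becomes a reflecting boundary condition, which the determinant satisfies because the
  derivative of a column is proportional to the next column.

  On the diagonal, row and column operations turn the determinant into \<open>det (\<integral> P\<^sub>i Q\<^sub>j)\<close>, an integral over
  ordered configurations of \<open>det (P\<^sub>i (x\<^sub>j)) det (Q\<^sub>i (x\<^sub>j))\<close>; since the rates form arithmetic progressions, both
  determinants are of Vandermonde type.  Constants need not be tracked, because both laws have mass one.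
  Finally, \<open>L\<^sub>2\<close> is \<open>L\<^sub>1\<close> with the rows reversed, which replaces \<open>(\<alpha>, \<eta>)\<close> by \<open>(\<alpha> + \<eta> M, - \<eta>)\<close>, and this leaves
  the ensemble unchanged.
\<close>

section \<open>Determinants\<close>

text \<open>The obstacle is the maximum in the recursion. Adding one cell at a time, only one
  argument moves, and the condition on the maximum becomes a truncation of the earlier arguments at
  the moving one. The columns must then satisfy two relations at once:
  \<open>d/dx + rate k (n + 1)\<close> lowers the level from n + 1 to n, and
  \<open>exp (- \<eta> x) d/dx\<close> leads, up to a constant, from column k to column k + 1. They
  are compatible because multiplication by \<open>exp (- \<eta> x)\<close> raises the rate by
  \<eta>, the step between neighbouring rows. The progression along the columns makes iterated
  convolution kernels an exponential times a power of \<open>expdiff\<close>, which yields the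
  Vandermonde determinant in \<theta>. Reversing the rows makes the row step negative. Hence
  everything up to the tail formula for \<open>L1\<close> holds for real parameters of any sign,
  with only the rates assumed positive; nonnegative \<eta> and \<theta> enter in the comparison with
  the ensemble, whose weight must be nonnegative. Even the sign of the proportionality factor is not
  computed: it is forced by the total mass.\<close>

definition fdet :: "nat \<Rightarrow> (nat \<Rightarrow> nat \<Rightarrow> 'a::comm_ring_1) \<Rightarrow> 'a" where
  "fdet n f = Determinant.det (Matrix.mat n n (\<lambda>(i, j). f i j))"

lemma fdet_leibniz:
  "fdet n f = (\<Sum>p | p permutes {0..<n}. signof p * (\<Prod>j<n. f (p j) j))"
proof -
  have "fdet n f =
      (\<Sum>p | p permutes {0..<n}. signof p * (\<Prod>j<n. Matrix.mat n n (\<lambda>(i, j). f i j) $$ (p j, j)))"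
    unfolding fdet_def by (rule det_col) auto
  also have "\<dots> = (\<Sum>p | p permutes {0..<n}. signof p * (\<Prod>j<n. f (p j) j))"
    by (intro sum.cong refl arg_cong2[where f = "(*)"] prod.cong) (auto dest: permutes_in_image)
  finally show ?thesis .
qed

lemma fdet_cong:
  "(\<And>i j. i < n \<Longrightarrow> j < n \<Longrightarrow> f i j = g i j) \<Longrightarrow> fdet n f = fdet n g"
  unfolding fdet_def by (intro arg_cong[where f = Determinant.det] eq_matI) auto

lemma fdet_transpose: "fdet n (\<lambda>i j. f j i) = fdet n f"
proof -
  have "Matrix.mat n n (\<lambda>(i, j). f j i) = transpose_mat (Matrix.mat n n (\<lambda>(i, j). f i j))"
    by (intro eq_matI) auto
  then show ?thesis unfolding fdet_def by (simp only: det_transpose[OF mat_carrier])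
qed

lemma fdet_mult: "fdet n (\<lambda>i j. \<Sum>k<n. f i k * g k j) = fdet n f * fdet n g"
proof -
  let ?A = "Matrix.mat n n (\<lambda>(i, j). f i j)" and ?B = "Matrix.mat n n (\<lambda>(i, j). g i j)"
  have "Matrix.mat n n (\<lambda>(i, j). \<Sum>k<n. f i k * g k j) = ?A * ?B"
    by (intro eq_matI) (auto simp: scalar_prod_def atLeast0LessThan)
  then show ?thesis unfolding fdet_def by (simp add: det_mult[where n = n])
qed

lemma fdet_scale_columns: "fdet n (\<lambda>i j. c j * f i j) = (\<Prod>j<n. c j) * fdet n f"
  unfolding fdet_leibniz by (simp add: prod.distrib sum_distrib_left mult_ac)

lemma fdet_lower_triangular:
  assumes "\<And>i j. i < j \<Longrightarrow> j < n \<Longrightarrow> f i j = 0"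
  shows "fdet n f = (\<Prod>i<n. f i i)"
proof -
  have "fdet n f = prod_list (diag_mat (Matrix.mat n n (\<lambda>(i, j). f i j)))"
    unfolding fdet_def by (rule det_lower_triangular[where n = n]) (use assms in auto)
  also have "\<dots> = (\<Prod>i<n. f i i)"
    by (simp add: prod_list_diag_prod atLeast0LessThan)
  finally show ?thesis .
qed

lemma fdet_upper_triangular:
  assumes "\<And>i j. j < i \<Longrightarrow> i < n \<Longrightarrow> f i j = 0"
  shows "fdet n f = (\<Prod>i<n. f i i)"
  by (subst fdet_transpose[symmetric]) (rule fdet_lower_triangular, rule assms)

text \<open>This removes the unwanted terms at the reflecting boundary and the configurations with
  coinciding points.\<close>

lemma fdet_proportional_columns:
  assumes "j < n" "k < n" "j \<noteq> k" "\<And>i. i < n \<Longrightarrow> f i j = c * f i k"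
  shows "fdet n f = 0"
proof -
  define g where "g = (\<lambda>i l. if l = j then f i k else f i l)"
  have "fdet n f = fdet n (\<lambda>i l. (if l = j then c else 1) * g i l)"
    by (rule fdet_cong) (use assms in \<open>auto simp: g_def\<close>)
  also have "\<dots> = (\<Prod>l<n. if l = j then c else 1) * fdet n g"
    by (rule fdet_scale_columns)
  also have "fdet n g = 0"
    unfolding fdet_def
    by (rule det_identical_columns[where n = n and i = j and j = k])
       (use assms in \<open>auto simp: g_def intro!: eq_vecI\<close>)
  finally show ?thesis by simp
qed

lemma fdet_zero_column:
  assumes "j < n" "\<And>i. i < n \<Longrightarrow> f i j = 0"
  shows "fdet n f = 0"
  unfolding fdet_leibniz
proof (intro sum.neutral ballI)
  fix p assume "p \<in> {p. p permutes {0..<n}}"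
  then have "p j < n" using assms(1) permutes_in_image[of p "{0..<n}" j] by simp
  then have "(\<Prod>j<n. f (p j) j) = 0" using assms by (intro prod_zero) auto
  then show "signof p * (\<Prod>j<n. f (p j) j) = 0" by simp
qed

lemma fdet_permute_rows:
  assumes "p permutes {0..<n}"
  shows "fdet n (\<lambda>i j. f (p i) j) = signof p * fdet n f"
proof -
  have "Matrix.mat n n (\<lambda>(i, j). f (p i) j) =
      Matrix.mat n n (\<lambda>(i, j). Matrix.mat n n (\<lambda>(i, j). f i j) $$ (p i, j))"
    using assms by (intro eq_matI) (auto dest: permutes_in_image)
  then show ?thesis unfolding fdet_def
    using det_permute_rows[OF _ assms, of "Matrix.mat n n (\<lambda>(i, j). f i j)"] by simp
qed

lemma fdet_permute_columns:
  assumes "p permutes {0..<n}"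
  shows "fdet n (\<lambda>i j. f i (p j)) = signof p * fdet n f"
  by (subst (1 2) fdet_transpose[symmetric]) (rule fdet_permute_rows[OF assms])

lemma fdet_column_diff:
  fixes f :: "nat \<Rightarrow> nat \<Rightarrow> real"
  assumes "k < n"
  shows "fdet n (\<lambda>i j. if j = k then a i - c * b i else f i j) =
    fdet n (\<lambda>i j. if j = k then a i else f i j) - c * fdet n (\<lambda>i j. if j = k then b i else f i j)"
proof -
  have split: "(\<Prod>j<n. if j = k then v (p j) else f (p j) j) = v (p k) * (\<Prod>j\<in>{..<n} - {k}. f (p j) j)"
    for v :: "nat \<Rightarrow> real" and p
    by (subst prod.remove[of _ k]) (use assms in \<open>auto intro!: prod.cong\<close>)
  show ?thesis
    unfolding fdet_leibniz split split[of "\<lambda>i. a i - c * b i"] by (simp add: algebra_simps sum_subtractf sum_distrib_left)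
qed

lemma fdet_has_real_derivative:
  fixes f :: "nat \<Rightarrow> nat \<Rightarrow> real \<Rightarrow> real"
  assumes "\<And>i j. i < n \<Longrightarrow> j < n \<Longrightarrow> (f i j has_real_derivative f' i j) (at y)"
  shows "((\<lambda>y. fdet n (\<lambda>i j. f i j y)) has_real_derivative
    (\<Sum>k<n. fdet n (\<lambda>i j. if j = k then f' i j else f i j y))) (at y)"
proof -
  let ?P = "{p. p permutes {0..<n}}"
  have "((\<lambda>y. \<Sum>p\<in>?P. signof p * (\<Prod>j<n. f (p j) j y)) has_real_derivative
      (\<Sum>p\<in>?P. signof p * (\<Sum>k<n. f' (p k) k * (\<Prod>j\<in>{..<n} - {k}. f (p j) j y)))) (at y)"
    by (intro DERIV_sum DERIV_cmult has_field_derivative_prod)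
       (auto intro!: assms simp: permutes_in_image)
  also have "(\<Sum>p\<in>?P. signof p * (\<Sum>k<n. f' (p k) k * (\<Prod>j\<in>{..<n} - {k}. f (p j) j y))) =
      (\<Sum>p\<in>?P. \<Sum>k<n. signof p * (\<Prod>j<n. if j = k then f' (p j) j else f (p j) j y))"
  proof (intro sum.cong refl)
    fix p
    have "(\<Prod>j<n. if j = k then f' (p j) j else f (p j) j y) =
        f' (p k) k * (\<Prod>j\<in>{..<n} - {k}. f (p j) j y)" if "k < n" for k
      by (subst prod.remove[of _ k]) (use that in \<open>auto intro!: prod.cong\<close>)
    then show "signof p * (\<Sum>k<n. f' (p k) k * (\<Prod>j\<in>{..<n} - {k}. f (p j) j y)) =
        (\<Sum>k<n. signof p * (\<Prod>j<n. if j = k then f' (p j) j else f (p j) j y))"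
      by (simp add: sum_distrib_left)
  qed
  also have "\<dots> = (\<Sum>k<n. fdet n (\<lambda>i j. if j = k then f' i j else f i j y))"
    unfolding fdet_leibniz by (rule sum.swap)
  finally show ?thesis unfolding fdet_leibniz .
qed

lemma continuous_on_fdet:
  fixes f :: "nat \<Rightarrow> nat \<Rightarrow> 'b::topological_space \<Rightarrow> real"
  assumes "\<And>i j. i < n \<Longrightarrow> j < n \<Longrightarrow> continuous_on S (f i j)"
  shows "continuous_on S (\<lambda>y. fdet n (\<lambda>i j. f i j y))"
  unfolding fdet_leibniz
  by (intro continuous_on_sum continuous_on_mult continuous_on_const continuous_on_prod assms)
     (simp_all add: permutes_in_image)

lemma fdet_first_column:
  assumes "\<And>i. 0 < i \<Longrightarrow> i \<le> n \<Longrightarrow> f i 0 = 0"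
  shows "fdet (Suc n) f = f 0 0 * fdet n (\<lambda>i j. f (Suc i) (Suc j))"
proof -
  let ?A = "Matrix.mat (Suc n) (Suc n) (\<lambda>(i, j). f i j)"
  have "fdet (Suc n) f = (\<Sum>i<Suc n. ?A $$ (i, 0) * cofactor ?A i 0)"
    unfolding fdet_def by (rule laplace_expansion_column) auto
  also have "\<dots> = (\<Sum>i\<in>{0}. ?A $$ (i, 0) * cofactor ?A i 0)"
    using assms by (intro sum.mono_neutral_right) auto
  also have "\<dots> = f 0 0 * Determinant.det (mat_delete ?A 0 0)"
    by (simp add: cofactor_def)
  also have "mat_delete ?A 0 0 = Matrix.mat n n (\<lambda>(i, j). f (Suc i) (Suc j))"
    by (intro eq_matI) (auto simp: mat_delete_def)
  finally show ?thesis by (simp add: fdet_def)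
qed

text \<open>Subtracting \<open>y 0\<close> times row i - 1 from row i is left multiplication by the
  unit lower bidiagonal matrix \<open>B\<close>. The new rows carry the factor
  \<open>y j - y 0\<close>, so column 0 is cleared below its top entry and the other columns are a
  scaled Vandermonde matrix of size n.\<close>

lemma fdet_vandermonde:
  fixes y :: "nat \<Rightarrow> 'a::comm_ring_1"
  shows "fdet n (\<lambda>i j. y j ^ i) = (\<Prod>j<n. \<Prod>i<j. y j - y i)"
proof (induction n arbitrary: y)
  case 0
  show ?case by (simp add: fdet_leibniz)
next
  case (Suc n)
  define B where "B = (\<lambda>i k :: nat. if k = i then 1 else if Suc k = i then - y 0 else 0)"
  define W where "W = (\<lambda>i j. if i = 0 then 1 else y j ^ (i - 1) * (y j - y 0))"
  have "fdet (Suc n) W = fdet (Suc n) (\<lambda>i j. \<Sum>k<Suc n. B i k * y j ^ k)"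
  proof (rule fdet_cong)
    fix i j assume i: "i < Suc n"
    show "W i j = (\<Sum>k<Suc n. B i k * y j ^ k)"
    proof (cases i)
      case 0
      have "(\<Sum>k<Suc n. B i k * y j ^ k) = (\<Sum>k\<in>{0}. B i k * y j ^ k)"
        using 0 by (intro sum.mono_neutral_right) (auto simp: B_def)
      then show ?thesis using 0 by (simp add: B_def W_def)
    next
      case (Suc l)
      have "(\<Sum>k<Suc n. B i k * y j ^ k) = (\<Sum>k\<in>{l, Suc l}. B i k * y j ^ k)"
        using Suc i by (intro sum.mono_neutral_right) (auto simp: B_def)
      then show ?thesis using Suc by (simp add: B_def W_def algebra_simps)
    qed
  qed
  also have "\<dots> = fdet (Suc n) B * fdet (Suc n) (\<lambda>i j. y j ^ i)"
    by (rule fdet_mult)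
  also have "fdet (Suc n) B = 1"
    by (subst fdet_lower_triangular) (auto simp: B_def)
  finally have "fdet (Suc n) (\<lambda>i j. y j ^ i) = fdet (Suc n) W" by simp
  also have "\<dots> = W 0 0 * fdet n (\<lambda>i j. W (Suc i) (Suc j))"
    by (rule fdet_first_column) (auto simp: W_def)
  also have "\<dots> = fdet n (\<lambda>i j. (y (Suc j) - y 0) * y (Suc j) ^ i)"
    by (simp add: W_def mult.commute)
  also have "\<dots> = (\<Prod>j<n. y (Suc j) - y 0) * (\<Prod>j<n. \<Prod>i<j. y (Suc j) - y (Suc i))"
    unfolding fdet_scale_columns Suc.IH[of "\<lambda>j. y (Suc j)"] by simp
  also have "\<dots> = (\<Prod>j<n. (y (Suc j) - y 0) * (\<Prod>i<j. y (Suc j) - y (Suc i)))"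
    by (simp add: prod.distrib)
  also have "\<dots> = (\<Prod>j<n. \<Prod>i<Suc j. y (Suc j) - y i)"
    by (simp only: prod.lessThan_Suc_shift)
  also have "\<dots> = (\<Prod>j<Suc n. \<Prod>i<j. y j - y i)"
    by (subst (2) prod.lessThan_Suc_shift) simp
  finally show ?case .
qed

section \<open>Integrals over a Weyl chamber\<close>

text \<open>Stated for sigma-finite factors because it is applied to Lebesgue measure: once to
  permute the variables, once to move the index set from \<open>{1..M}\<close> to
  \<open>{..<M}\<close>.\<close>

lemma distr_PiM_reindex_sigma_finite:
  assumes M: "sigma_finite_measure M" and I: "finite I" and f: "bij_betw f I K"
  shows "distr (PiM K (\<lambda>_. M)) (PiM I (\<lambda>_. M)) (\<lambda>x. \<lambda>i\<in>I. x (f i)) = PiM I (\<lambda>_. M)"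
proof -
  interpret sigma_finite_measure M by fact
  interpret product_sigma_finite "\<lambda>_. M" by standard
  have K: "finite K" using bij_betw_finite[OF f] I by simp
  have fK: "f i \<in> K" if "i \<in> I" for i using f that by (auto simp: bij_betw_def)
  have [measurable]: "(\<lambda>x. \<lambda>i\<in>I. x (f i)) \<in> measurable (PiM K (\<lambda>_. M)) (PiM I (\<lambda>_. M))"
    by (intro measurable_restrict measurable_component_singleton fK)
  show ?thesis
  proof (rule PiM_eqI)
    fix A assume A: "\<And>i. i \<in> I \<Longrightarrow> A i \<in> sets M"
    define g where "g = the_inv_into I f"
    have g: "g (f i) = i" if "i \<in> I" for i
      unfolding g_def using f that by (simp add: bij_betw_def the_inv_into_f_f)
    have gK: "g k \<in> I" "f (g k) = k" if "k \<in> K" for k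
      unfolding g_def using f that
      by (auto simp: bij_betw_def f_the_inv_into_f intro!: the_inv_into_into)
    have "(\<lambda>x. \<lambda>i\<in>I. x (f i)) -` PiE I A \<inter> space (PiM K (\<lambda>_. M)) = PiE K (\<lambda>k. A (g k))"
    proof (intro equalityI subsetI)
      fix x assume x: "x \<in> (\<lambda>x. \<lambda>i\<in>I. x (f i)) -` PiE I A \<inter> space (PiM K (\<lambda>_. M))"
      have "x k \<in> A (g k)" if "k \<in> K" for k
        using x gK[OF that] by (auto simp: PiE_iff)
      then show "x \<in> PiE K (\<lambda>k. A (g k))" using x by (auto simp: space_PiM PiE_iff)
    next
      fix x assume x: "x \<in> PiE K (\<lambda>k. A (g k))"
      have "x (f i) \<in> A i" if "i \<in> I" for i using x fK[OF that] g[OF that] by (auto simp: PiE_iff)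
      moreover have "x k \<in> space M" if "k \<in> K" for k
        using x gK[OF that] that sets.sets_into_space[OF A[of "g k"]] by (auto simp: PiE_iff)
      ultimately show "x \<in> (\<lambda>x. \<lambda>i\<in>I. x (f i)) -` PiE I A \<inter> space (PiM K (\<lambda>_. M))"
        using x by (auto simp: space_PiM PiE_iff)
    qed
    then have "emeasure (distr (PiM K (\<lambda>_. M)) (PiM I (\<lambda>_. M)) (\<lambda>x. \<lambda>i\<in>I. x (f i))) (PiE I A) =
        emeasure (PiM K (\<lambda>_. M)) (PiE K (\<lambda>k. A (g k)))"
      using A I by (subst emeasure_distr) (auto intro!: sets_PiM_I_finite)
    also have "\<dots> = (\<Prod>k\<in>K. emeasure M (A (g k)))"
      using K A gK by (intro emeasure_PiM) auto
    also have "\<dots> = (\<Prod>i\<in>I. emeasure M (A i))"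
      by (subst prod.reindex_bij_betw[OF f, symmetric]) (simp add: g cong: prod.cong)
    finally show "emeasure (distr (PiM K (\<lambda>_. M)) (PiM I (\<lambda>_. M)) (\<lambda>x. \<lambda>i\<in>I. x (f i))) (PiE I A) =
        (\<Prod>i\<in>I. emeasure M (A i))" .
  qed (use I in simp_all)
qed

text \<open>Both reorderings list the same set in increasing order, so they agree as lists of
  values; injectivity of \<open>x\<close> turns this into equality of indices.\<close>

lemma sorting_permutation_unique:
  fixes x :: "nat \<Rightarrow> 'b::linorder"
  assumes p: "p permutes {0..<n}" "strict_mono_on {..<n} (\<lambda>i. x (p i))"
    and q: "q permutes {0..<n}" "strict_mono_on {..<n} (\<lambda>i. x (q i))"
    and inj: "inj_on x {0..<n}"
  shows "p = q"
proof -
  have sorted: "sorted_wrt (<) (map (\<lambda>i. x (p i)) [0..<n])" "set (map (\<lambda>i. x (p i)) [0..<n]) = x ` {0..<n}"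
    if "p permutes {0..<n}" "strict_mono_on {..<n} (\<lambda>i. x (p i))" for p
    using that permutes_image[OF that(1)]
    by (auto simp: sorted_wrt_iff_nth_less strict_mono_on_def image_image[symmetric]
        simp del: atLeastLessThan_iff)
  have "map (\<lambda>i. x (p i)) [0..<n] = map (\<lambda>i. x (q i)) [0..<n]"
    using sorted[OF p] sorted[OF q]
    by (intro sorted_distinct_set_unique) (simp_all add: strict_sorted_iff)
  then have eq: "x (p i) = x (q i)" if "i < n" for i using that by (simp add: map_eq_conv)
  show "p = q"
  proof
    fix i
    show "p i = q i"
    proof (cases "i < n")
      case True
      then have "p i \<in> {0..<n}" "q i \<in> {0..<n}"
        using permutes_in_image[OF p(1)] permutes_in_image[OF q(1)] by simp_all
      then show ?thesis using inj eq[OF True] by (auto dest: inj_onD)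
    next
      case False
      then show ?thesis using p(1) q(1) by (simp add: permutes_def)
    qed
  qed
qed

lemma sorting_permutation_exists:
  fixes x :: "nat \<Rightarrow> 'b::linorder"
  assumes inj: "inj_on x {0..<n}"
  shows "\<exists>p. p permutes {0..<n} \<and> strict_mono_on {..<n} (\<lambda>i. x (p i))"
proof -
  have card: "card (x ` {0..<n}) = n" using card_image[OF inj] by simp
  define h where "h = (!) (sorted_list_of_set (x ` {0..<n}))"
  have h: "bij_betw h {..<n} (x ` {0..<n})" "strict_mono_on {..<n} h"
    unfolding h_def using card sorted_wrt_nth_less[OF strict_sorted_list_of_set[of "x ` {0..<n}"]]
    by (auto intro!: bij_betw_nth strict_mono_onI)
  define p where "p = (\<lambda>i. if i < n then inv_into {0..<n} x (h i) else i)"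
  have xp: "x (p i) = h i" if "i < n" for i
    using that h(1) by (auto simp: p_def bij_betw_def intro!: f_inv_into_f)
  have "bij_betw (inv_into {0..<n} x \<circ> h) {0..<n} {0..<n}"
    using h(1) inj_on_imp_bij_betw[OF inj]
    by (intro bij_betw_trans[OF _ bij_betw_inv_into]) (auto simp: atLeast0LessThan)
  then have "bij_betw p {0..<n} {0..<n}" by (rule bij_betw_cong[THEN iffD1, rotated]) (simp add: p_def)
  then have "p permutes {0..<n}" by (rule bij_imp_permutes) (simp add: p_def)
  moreover have "strict_mono_on {..<n} (\<lambda>i. x (p i))"
    using h(2) by (simp add: strict_mono_on_def xp)
  ultimately show ?thesis by blast
qed

text \<open>The product of two determinants is symmetric in the variables and vanishes on coinciding
  variables, so that its integral is \<open>n!\<close> times its integral over a Weyl chamber.\<close>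

lemma andreief:
  fixes P Q :: "nat \<Rightarrow> 'b::linorder \<Rightarrow> real"
  assumes M: "sigma_finite_measure M"
    and P [measurable]: "\<And>i. P i \<in> borel_measurable M"
    and Q [measurable]: "\<And>i. Q i \<in> borel_measurable M"
    and int: "\<And>i j. i < n \<Longrightarrow> j < n \<Longrightarrow> integrable M (\<lambda>y. P i y * Q j y)"
    and S [measurable]: "Measurable.pred (PiM {..<n} (\<lambda>_. M)) (strict_mono_on {..<n})"
  shows "integrable (PiM {..<n} (\<lambda>_. M)) (\<lambda>x. indicator {x. strict_mono_on {..<n} x} x *
      (fdet n (\<lambda>i j. P i (x j)) * fdet n (\<lambda>i j. Q i (x j))))"
    and "(\<integral>x. indicator {x. strict_mono_on {..<n} x} x *
      (fdet n (\<lambda>i j. P i (x j)) * fdet n (\<lambda>i j. Q i (x j))) \<partial>PiM {..<n} (\<lambda>_. M)) =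
      fdet n (\<lambda>i j. \<integral>y. P i y * Q j y \<partial>M)"
proof -
  interpret sigma_finite_measure M by fact
  interpret product_sigma_finite "\<lambda>_. M" by standard
  let ?M = "PiM {..<n} (\<lambda>_. M)" and ?P = "{p. p permutes {0..<n}}"
  define F where "F = (\<lambda>x. fdet n (\<lambda>i j. P i (x j)) * fdet n (\<lambda>i j. Q i (x j)))"
  define C where "C = (\<lambda>x. indicator {x. strict_mono_on {..<n} x} x * F x :: real)"
  have F_expand: "F x = (\<Sum>p\<in>?P. \<Sum>q\<in>?P. signof p * signof q * (\<Prod>j<n. P (p j) (x j) * Q (q j) (x j)))" for x
    unfolding F_def fdet_leibniz by (simp add: sum_product prod.distrib mult_ac)
  have prods: "integrable ?M (\<lambda>x. \<Prod>j<n. P (p j) (x j) * Q (q j) (x j))"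
    "(\<integral>x. (\<Prod>j<n. P (p j) (x j) * Q (q j) (x j)) \<partial>?M) = (\<Prod>j<n. \<integral>y. P (p j) y * Q (q j) y \<partial>M)"
    if "p \<in> ?P" "q \<in> ?P" for p q
    using that
    by (intro product_integrable_prod product_integral_prod int; simp add: permutes_in_image)+
  have F_int: "integrable ?M F"
    unfolding F_expand
    by (intro Bochner_Integration.integrable_sum Bochner_Integration.integrable_mult_right prods)
  have [measurable]: "F \<in> borel_measurable ?M" using F_int by simp
  have Cm [measurable]: "C \<in> borel_measurable ?M" unfolding C_def by measurable
  have C_int: "integrable ?M C"
    by (rule Bochner_Integration.integrable_bound[OF F_int Cm]) (auto simp: C_def indicator_def)
  then show "integrable ?M (\<lambda>x. indicator {x. strict_mono_on {..<n} x} x *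
      (fdet n (\<lambda>i j. P i (x j)) * fdet n (\<lambda>i j. Q i (x j))))"
    by (simp add: C_def F_def)
  have "(\<integral>x. F x \<partial>?M) = (\<Sum>p\<in>?P. \<Sum>q\<in>?P. signof p * signof q * (\<Prod>j<n. \<integral>y. P (p j) y * Q (q j) y \<partial>M))"
    (is "_ = ?R")
  proof -
    have "(\<integral>x. F x \<partial>?M) =
        (\<Sum>p\<in>?P. \<integral>x. (\<Sum>q\<in>?P. signof p * signof q * (\<Prod>j<n. P (p j) (x j) * Q (q j) (x j))) \<partial>?M)"
      unfolding F_expand
      by (intro Bochner_Integration.integral_sum Bochner_Integration.integrable_sum
          Bochner_Integration.integrable_mult_right prods)
    also have "\<dots> = (\<Sum>p\<in>?P. \<Sum>q\<in>?P.
        \<integral>x. signof p * signof q * (\<Prod>j<n. P (p j) (x j) * Q (q j) (x j)) \<partial>?M)"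
      by (intro sum.cong refl Bochner_Integration.integral_sum
          Bochner_Integration.integrable_mult_right prods)
    also have "\<dots> = ?R"
      by (intro sum.cong refl) (simp only: Bochner_Integration.integral_mult_right_zero prods)
    finally show ?thesis .
  qed
  also have "\<dots> = (\<Sum>q\<in>?P. signof q * fdet n (\<lambda>i j. \<integral>y. P i y * Q (q j) y \<partial>M))"
    unfolding fdet_leibniz by (subst sum.swap) (simp add: sum_distrib_left mult_ac)
  \<comment> \<open>Permuting the columns back produces a second sign of \<open>q\<close>, which
    cancels the first, so all n! summands are equal.\<close>
  also have "\<dots> = (\<Sum>q\<in>?P. fdet n (\<lambda>i j. \<integral>y. P i y * Q j y \<partial>M))"
  proof (intro sum.cong refl)
    fix q assume "q \<in> ?P"
    then have "fdet n (\<lambda>i j. \<integral>y. P i y * Q (q j) y \<partial>M) = signof q * fdet n (\<lambda>i j. \<integral>y. P i y * Q j y \<partial>M)"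
      by (intro fdet_permute_columns[of q n "\<lambda>i j. \<integral>y. P i y * Q j y \<partial>M"]) simp
    then show "signof q * fdet n (\<lambda>i j. \<integral>y. P i y * Q (q j) y \<partial>M) = fdet n (\<lambda>i j. \<integral>y. P i y * Q j y \<partial>M)"
      by (simp add: sign_def)
  qed
  finally have total: "(\<integral>x. F x \<partial>?M) = real (card ?P) * fdet n (\<lambda>i j. \<integral>y. P i y * Q j y \<partial>M)"
    by simp
  define T where "T = (\<lambda>p (x :: nat \<Rightarrow> 'b). \<lambda>i\<in>{..<n}. x (p i))"
  have F_T: "F (T p x) = F x" if "p \<in> ?P" for p x
  proof -
    have "F (T p x) = fdet n (\<lambda>i j. P i (x (p j))) * fdet n (\<lambda>i j. Q i (x (p j)))"
      unfolding F_def T_def by (intro arg_cong2[where f = "(*)"] fdet_cong) auto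
    also have "\<dots> = (signof p * signof p) * F x"
      using that by (simp add: F_def fdet_permute_columns[of p n "\<lambda>i j. P i (x j)"]
        fdet_permute_columns[of p n "\<lambda>i j. Q i (x j)"])
    finally show ?thesis by (simp add: sign_def split: if_splits)
  qed
  have mono_T: "strict_mono_on {..<n} (T p x) \<longleftrightarrow> strict_mono_on {..<n} (\<lambda>i. x (p i))" for p x
    by (auto simp: strict_mono_on_def T_def)
  \<comment> \<open>For injective \<open>x\<close> exactly one permutation sorts it, so a single
    summand survives, and \<open>F\<close> is symmetric. Otherwise two columns coincide and both
    sides are 0.\<close>
  have F_sum: "F x = (\<Sum>p\<in>?P. C (T p x))" for x
  proof (cases "inj_on x {0..<n}")
    case True
    obtain p where p: "p permutes {0..<n}" "strict_mono_on {..<n} (\<lambda>i. x (p i))"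
      using sorting_permutation_exists[OF True] by blast
    have "(\<Sum>q\<in>?P. C (T q x)) = (\<Sum>q\<in>{p}. C (T q x))"
    proof (intro sum.mono_neutral_right ballI)
      fix q assume "q \<in> ?P - {p}"
      then have "\<not> strict_mono_on {..<n} (\<lambda>i. x (q i))"
        using sorting_permutation_unique[OF p _ _ True] by auto
      then show "C (T q x) = 0" by (simp add: C_def mono_T)
    qed (use p in \<open>auto simp: finite_permutations\<close>)
    then show ?thesis using p by (simp add: C_def mono_T F_T)
  next
    case False
    then obtain i j where ij: "i < n" "j < n" "i \<noteq> j" "x i = x j" by (auto simp: inj_on_def)
    have "F x = 0"
      unfolding F_def using fdet_proportional_columns[of i n j "\<lambda>i j. P i (x j)" 1] ij by simp
    then show ?thesis by (simp add: C_def F_T)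
  qed
  have inv: "integrable ?M (\<lambda>x. C (T p x))" "(\<integral>x. C (T p x) \<partial>?M) = (\<integral>x. C x \<partial>?M)" if "p \<in> ?P" for p
  proof -
    have D: "distr ?M ?M (T p) = ?M"
      unfolding T_def using that
      by (intro distr_PiM_reindex_sigma_finite M) (auto simp: atLeast0LessThan permutes_imp_bij)
    have Tm: "T p \<in> measurable ?M ?M"
      unfolding T_def using that permutes_in_image[of p "{0..<n}"]
      by (intro measurable_restrict measurable_component_singleton) auto
    show "(\<integral>x. C (T p x) \<partial>?M) = (\<integral>x. C x \<partial>?M)"
      using integral_distr[OF Tm Cm] D by simp
    show "integrable ?M (\<lambda>x. C (T p x))"
      using integrable_distr[OF Tm, of C] C_int unfolding D by simp
  qed
  have "(\<integral>x. F x \<partial>?M) = (\<Sum>p\<in>?P. \<integral>x. C (T p x) \<partial>?M)"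
    unfolding F_sum by (rule Bochner_Integration.integral_sum) (rule inv)
  also have "\<dots> = real (card ?P) * (\<integral>x. C x \<partial>?M)" by (simp add: inv)
  finally have "(\<integral>x. C x \<partial>?M) = fdet n (\<lambda>i j. \<integral>y. P i y * Q j y \<partial>M)"
    using total by (simp add: card_permutations)
  then show "(\<integral>x. indicator {x. strict_mono_on {..<n} x} x *
      (fdet n (\<lambda>i j. P i (x j)) * fdet n (\<lambda>i j. Q i (x j))) \<partial>?M) =
      fdet n (\<lambda>i j. \<integral>y. P i y * Q j y \<partial>M)"
    by (simp add: C_def F_def)
qed

section \<open>The functions in the determinantal formula\<close>

text \<open>The integral of \<open>exp (s * u)\<close> for u from 0 to x. Including s = 0 lets
  vanishing \<eta> or \<theta> be treated together with the other cases.\<close>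

definition expdiff :: "real \<Rightarrow> real \<Rightarrow> real" where
  "expdiff s x = (if s = 0 then x else (exp (s * x) - 1) / s)"

lemma expdiff_has_real_derivative [derivative_intros]:
  "(f has_real_derivative f') (at x within S) \<Longrightarrow>
   ((\<lambda>x. expdiff s (f x)) has_real_derivative exp (s * f x) * f') (at x within S)"
  by (cases "s = 0") (auto simp: expdiff_def intro!: derivative_eq_intros)

lemma continuous_on_expdiff [continuous_intros]:
  "continuous_on S f \<Longrightarrow> continuous_on S (\<lambda>x. expdiff s (f x))"
  unfolding expdiff_def by (cases "s = 0") (auto intro!: continuous_intros)

lemma expdiff_0 [simp]: "expdiff s 0 = 0"
  by (simp add: expdiff_def)

lemma expdiff_diff: "expdiff s (x - y) = expdiff s x + exp (s * x) * expdiff s (- y)"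
  by (simp add: expdiff_def field_simps exp_diff exp_minus)

lemma expdiff_minus_eq: "expdiff s x = exp (s * x) * expdiff (- s) x"
  by (simp add: expdiff_def field_simps exp_minus)

lemma exp_eq_expdiff: "exp (s * x) = 1 + s * expdiff s x"
  by (simp add: expdiff_def)

locale arithmetic_rates =
  fixes \<eta> \<theta> \<rho> :: real
begin

definition rate :: "nat \<Rightarrow> nat \<Rightarrow> real" where
  "rate k n = \<rho> + \<eta> * real k + \<theta> * real n"

text \<open>Here \<open>rate k n\<close> belongs to the cell \<open>(k + 1, n)\<close>.  The factor \<open>(k + 1) exp (\<eta> x)\<close> in
  \<open>chi_derivatives\<close> does not depend on \<open>i\<close>: this makes columns of determinants proportional.\<close>

fun chi :: "nat \<Rightarrow> nat \<Rightarrow> nat \<Rightarrow> real \<Rightarrow> real" where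
  "chi 0 i k x = real (i choose k) * expdiff \<eta> x ^ (i - k)"
| "chi (Suc n) i 0 x =
    exp (- rate 0 (Suc n) * x) * integral {0..x} (\<lambda>y. exp (rate 0 (Suc n) * y) * chi n i 0 y)"
| "chi (Suc n) i (Suc k) x =
    exp (- \<eta> * x) / real (Suc k) * (chi n i k x - rate k (Suc n) * chi (Suc n) i k x)"

lemma chi_0_derivative:
  "(chi 0 i k has_real_derivative real (Suc k) * exp (\<eta> * x) * chi 0 i (Suc k) x) (at x within S)"
proof -
  have D: "((\<lambda>x. real (i choose k) * expdiff \<eta> x ^ (i - k)) has_real_derivative
      real (i choose k) * (real (i - k) * (exp (\<eta> * x) * expdiff \<eta> x ^ (i - Suc k)))) (at x within S)"
    by (auto intro!: derivative_eq_intros)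
  have "Suc k * (i choose Suc k) = (i - k) * (i choose k)"
    by (simp only: binomial_absorb_comp binomial_absorption)
  then have "real (Suc k) * real (i choose Suc k) = real (i choose k) * real (i - k)"
    by (metis mult.commute of_nat_mult)
  then have rhs: "real (Suc k) * exp (\<eta> * x) * chi 0 i (Suc k) x =
      real (i choose k) * (real (i - k) * (exp (\<eta> * x) * expdiff \<eta> x ^ (i - Suc k)))"
    by (simp add: algebra_simps del: of_nat_Suc)
  have "chi 0 i k = (\<lambda>x. real (i choose k) * expdiff \<eta> x ^ (i - k))" by (rule ext) simp
  then show ?thesis using D rhs by (metis (no_types))
qed

lemma integral_has_real_derivative_atLeast:
  fixes f :: "real \<Rightarrow> real"
  assumes "continuous_on {0..} f" "0 \<le> x"
  shows "((\<lambda>x. integral {0..x} f) has_real_derivative f x) (at x within {0..})"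
proof -
  have "((\<lambda>x. integral {0..x} f) has_real_derivative f x) (at x within {0..x + 1})"
    using assms by (intro integral_has_real_derivative) (auto intro: continuous_on_subset)
  moreover have "at x within {0..x + 1} = at x within {0..}"
    by (rule at_within_nhd[of _ "{..<x + 1}"]) auto
  ultimately show ?thesis by simp
qed

text \<open>The third clause of \<open>chi\<close> is chosen to make the two formulas equivalent at
  level n + 1. The second one is proved by induction on k from the first one at level n: its case k
  = 0 is the convolution clause, and in the step the factor \<open>exp (- \<eta> * x)\<close>
  contributes \<open>- \<eta>\<close>, which turns \<open>rate k\<close> into
  \<open>rate (k + 1)\<close>. Derivatives are one-sided at 0, where the convolutions start.\<close>

lemma chi_derivatives:
  assumes "0 \<le> x"
  shows "(chi n i k has_real_derivative real (Suc k) * exp (\<eta> * x) * chi n i (Suc k) x) (at x within {0..})"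
    and "(chi (Suc n) i k has_real_derivative chi n i k x - rate k (Suc n) * chi (Suc n) i k x)
      (at x within {0..})"
proof -
  have B: "\<forall>x\<ge>0. (chi (Suc n) i k has_real_derivative chi n i k x - rate k (Suc n) * chi (Suc n) i k x)
      (at x within {0..})"
    if A: "\<forall>k. \<forall>x\<ge>0. (chi n i k has_real_derivative real (Suc k) * exp (\<eta> * x) * chi n i (Suc k) x)
      (at x within {0..})" for n k
  proof (induction k)
    case 0
    show ?case
    proof (intro allI impI)
      fix x :: real assume x: "0 \<le> x"
      let ?r = "rate 0 (Suc n)"
      have cont: "continuous_on {0..} (chi n i 0)"
        using A by (intro DERIV_continuous_on) auto
      have "((\<lambda>x. exp (- ?r * x) * integral {0..x} (\<lambda>y. exp (?r * y) * chi n i 0 y)) has_real_derivative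
          exp (- ?r * x) * (exp (?r * x) * chi n i 0 x) +
          exp (- ?r * x) * (- ?r) * integral {0..x} (\<lambda>y. exp (?r * y) * chi n i 0 y)) (at x within {0..})"
        by (rule DERIV_mult[THEN DERIV_cong])
           (use x cont in \<open>auto intro!: derivative_eq_intros integral_has_real_derivative_atLeast continuous_intros\<close>)
      moreover have "chi (Suc n) i 0 = (\<lambda>x. exp (- ?r * x) * integral {0..x} (\<lambda>y. exp (?r * y) * chi n i 0 y))"
        by (rule ext) simp
      ultimately have "(chi (Suc n) i 0 has_real_derivative
          exp (- ?r * x) * (exp (?r * x) * chi n i 0 x) +
          exp (- ?r * x) * (- ?r) * integral {0..x} (\<lambda>y. exp (?r * y) * chi n i 0 y)) (at x within {0..})"
        by (simp only:)
      then show "(chi (Suc n) i 0 has_real_derivative chi n i 0 x - ?r * chi (Suc n) i 0 x) (at x within {0..})"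
        by (rule DERIV_cong) (simp add: exp_minus)
    qed
  next
    case (Suc k)
    show ?case
    proof (intro allI impI)
      fix x :: real assume x: "0 \<le> x"
      let ?r = "rate k (Suc n)" and ?s = "real (Suc k)"
      have "((\<lambda>x. exp (- \<eta> * x) / ?s * (chi n i k x - ?r * chi (Suc n) i k x)) has_real_derivative
          exp (- \<eta> * x) * (- \<eta>) / ?s * (chi n i k x - ?r * chi (Suc n) i k x) +
          exp (- \<eta> * x) / ?s * (?s * exp (\<eta> * x) * chi n i (Suc k) x -
            ?r * (chi n i k x - ?r * chi (Suc n) i k x))) (at x within {0..})"
        by (rule derivative_eq_intros A[rule_format, OF x] Suc.IH[rule_format, OF x] refl | simp)+
      also have "exp (- \<eta> * x) * (- \<eta>) / ?s * (chi n i k x - ?r * chi (Suc n) i k x) +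
          exp (- \<eta> * x) / ?s * (?s * exp (\<eta> * x) * chi n i (Suc k) x -
            ?r * (chi n i k x - ?r * chi (Suc n) i k x)) =
          chi n i (Suc k) x - rate (Suc k) (Suc n) * chi (Suc n) i (Suc k) x"
      proof -
        have e: "exp (- \<eta> * x) / ?s * (?s * exp (\<eta> * x) * chi n i (Suc k) x) = chi n i (Suc k) x"
          by (simp add: exp_minus del: of_nat_Suc)
        have r: "rate (Suc k) (Suc n) = ?r + \<eta>" by (simp add: rate_def algebra_simps)
        show ?thesis
          unfolding right_diff_distrib e chi.simps(3) r by (simp add: algebra_simps add_divide_distrib)
      qed
      also have "(\<lambda>x. exp (- \<eta> * x) / ?s * (chi n i k x - ?r * chi (Suc n) i k x)) = chi (Suc n) i (Suc k)"
        by (rule ext) simp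
      finally show "(chi (Suc n) i (Suc k) has_real_derivative
          chi n i (Suc k) x - rate (Suc k) (Suc n) * chi (Suc n) i (Suc k) x) (at x within {0..})" .
    qed
  qed
  have A: "\<forall>k. \<forall>x\<ge>0. (chi n i k has_real_derivative real (Suc k) * exp (\<eta> * x) * chi n i (Suc k) x)
      (at x within {0..})" for n
  proof (induction n)
    case 0
    show ?case using chi_0_derivative by blast
  next
    case (Suc n)
    have eq: "chi n i k x - rate k (Suc n) * chi (Suc n) i k x =
        real (Suc k) * exp (\<eta> * x) * chi (Suc n) i (Suc k) x" for k x
      by (simp add: exp_minus del: of_nat_Suc)
    show ?case using B[OF Suc.IH] unfolding eq by blast
  qed
  show "(chi n i k has_real_derivative real (Suc k) * exp (\<eta> * x) * chi n i (Suc k) x) (at x within {0..})"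
    using A assms by blast
  show "(chi (Suc n) i k has_real_derivative chi n i k x - rate k (Suc n) * chi (Suc n) i k x)
      (at x within {0..})"
    using B[OF A] assms by blast
qed

lemma continuous_on_chi: "continuous_on {0..} (chi n i k)"
  using chi_derivatives(1) by (intro DERIV_continuous_on) auto

text \<open>The kernel \<open>K m\<close> collects the last \<open>m + 1\<close> convolutions; the induction step integrates
  \<open>K (m + 1) (t - y) chi (n - m) i 0 y\<close> by parts, the boundary terms being zero.\<close>

lemma chi_convolution:
  assumes t: "0 \<le> t" and m: "m \<le> n"
  defines "K \<equiv> \<lambda>m y. exp (- rate 0 (Suc n) * y) * expdiff \<theta> y ^ m / fact m"
  shows "chi (Suc n) i 0 t = integral {0..t} (\<lambda>y. K m (t - y) * chi (n - m) i 0 y)"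
  using m
proof (induction m)
  case 0
  have "chi (Suc n) i 0 t = integral {0..t} (\<lambda>y. exp (- rate 0 (Suc n) * t) * (exp (rate 0 (Suc n) * y) * chi n i 0 y))"
    by simp
  also have "\<dots> = integral {0..t} (\<lambda>y. K 0 (t - y) * chi (n - 0) i 0 y)"
    by (intro integral_cong) (simp add: K_def exp_add[symmetric] algebra_simps)
  finally show ?case .
next
  case (Suc m)
  then obtain l where l: "n - m = Suc l" "n - Suc m = l" by (cases "n - m") auto
  let ?r = "rate 0 (Suc n)"
  \<comment> \<open>Since \<open>exp (\<theta> y) = 1 + \<theta> expdiff \<theta> y\<close>,
    differentiating the power lowers the rate by \<open>\<theta> (m + 1)\<close>. What remains is
    the rate of column n - m, so the rate terms cancel in the integration by parts.\<close>
  have K_deriv: "(K (Suc m) has_real_derivative K m y - rate 0 (Suc l) * K (Suc m) y) (at y within S)" for y S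
  proof -
    have "((\<lambda>y. exp (- ?r * y) * expdiff \<theta> y ^ Suc m) has_real_derivative
        (- ?r) * exp (- ?r * y) * expdiff \<theta> y ^ Suc m +
        exp (- ?r * y) * (real (Suc m) * (1 + \<theta> * expdiff \<theta> y) * expdiff \<theta> y ^ m)) (at y within S)"
      by (rule derivative_eq_intros refl)+ (simp add: exp_eq_expdiff[symmetric] mult_ac)
    from DERIV_cdivide[OF this, of "fact (Suc m)"]
    have "(K (Suc m) has_real_derivative
        (- ?r) * exp (- ?r * y) * expdiff \<theta> y ^ Suc m / fact (Suc m) +
        exp (- ?r * y) * (real (Suc m) * (1 + \<theta> * expdiff \<theta> y) * expdiff \<theta> y ^ m) / fact (Suc m)) (at y within S)"
      unfolding K_def by (simp only: add_divide_distrib)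
    also have "(- ?r) * exp (- ?r * y) * expdiff \<theta> y ^ Suc m / fact (Suc m) +
        exp (- ?r * y) * (real (Suc m) * (1 + \<theta> * expdiff \<theta> y) * expdiff \<theta> y ^ m) / fact (Suc m) =
        K m y - (?r - \<theta> * real (Suc m)) * K (Suc m) y"
    proof -
      have alg: "(- r) * e * (x * p) / (s * f) + e * (s * (1 + \<theta> * x) * p) / (s * f) =
          e * p / f - (r - \<theta> * s) * (e * (x * p) / (s * f))" if "s \<noteq> 0" "f \<noteq> 0" for r e x p s f :: real
        using that by (simp add: field_simps)
      show ?thesis
        unfolding K_def power_Suc fact_Suc of_nat_mult of_nat_fact by (rule alg) simp_all
    qed
    also have "?r - \<theta> * real (Suc m) = rate 0 (Suc l)"
    proof -
      have "Suc n = Suc l + Suc m" using l by simp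
      then have "real (Suc n) = real (Suc l) + real (Suc m)" by (simp only: of_nat_add)
      then show ?thesis unfolding rate_def by (simp add: algebra_simps)
    qed
    finally show ?thesis .
  qed
  have "((\<lambda>y. K (Suc m) (t - y) * chi l i 0 y - K m (t - y) * chi (Suc l) i 0 y) has_integral
      (K (Suc m) (t - t) * chi (Suc l) i 0 t - K (Suc m) (t - 0) * chi (Suc l) i 0 0)) {0..t}"
  proof (rule fundamental_theorem_of_calculus[OF t])
    fix y assume y: "y \<in> {0..t}"
    have c: "(chi (Suc l) i 0 has_real_derivative chi l i 0 y - rate 0 (Suc l) * chi (Suc l) i 0 y) (at y within {0..t})"
      using chi_derivatives(2)[of y l i 0] y by (auto intro: DERIV_subset)
    have "((\<lambda>y. K (Suc m) (t - y)) has_real_derivative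
        (K m (t - y) - rate 0 (Suc l) * K (Suc m) (t - y)) * (0 - 1)) (at y within {0..t})"
      by (rule DERIV_chain2[OF K_deriv]) (rule derivative_eq_intros refl)+
    from DERIV_mult[OF this c]
    show "((\<lambda>y. K (Suc m) (t - y) * chi (Suc l) i 0 y) has_vector_derivative
        (K (Suc m) (t - y) * chi l i 0 y - K m (t - y) * chi (Suc l) i 0 y)) (at y within {0..t})"
      unfolding has_real_derivative_iff_has_vector_derivative[symmetric]
      by (rule DERIV_cong) (simp add: algebra_simps)
  qed
  moreover have "K (Suc m) 0 = 0" "chi (Suc l) i 0 0 = 0" by (simp_all add: K_def)
  ultimately have "integral {0..t} (\<lambda>y. K (Suc m) (t - y) * chi l i 0 y - K m (t - y) * chi (Suc l) i 0 y) = 0"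
    by (simp add: integral_unique del: chi.simps)
  moreover have int: "(\<lambda>y. K k (t - y) * chi j i 0 y) integrable_on {0..t}" for j k
    unfolding K_def
    by (intro integrable_continuous_real continuous_intros continuous_on_subset[OF continuous_on_chi]) auto
  ultimately show ?case
    using Suc by (simp add: l integral_diff del: chi.simps)
qed

text \<open>The case m = n of the convolution formula, with y replaced by t - y so that t enters the
  integrand only through the last power. Passing from \<open>expdiff \<theta>\<close> to
  \<open>expdiff (- \<theta>)\<close> absorbs the dependence of the rate on n: all columns then
  share the exponential with \<open>rate 0 1\<close>.\<close>

lemma chi_eq_integral:
  assumes t: "0 \<le> t"
  shows "chi (Suc n) i 0 t = integral {0..t}
    (\<lambda>y. exp (- rate 0 1 * y) * expdiff (- \<theta>) y ^ n / fact n * expdiff \<eta> (t - y) ^ i)"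
proof -
  have eq: "exp (- rate 0 (Suc n) * y) * expdiff \<theta> y ^ n = exp (- rate 0 1 * y) * expdiff (- \<theta>) y ^ n" for y
    by (simp add: expdiff_minus_eq[of \<theta>] power_mult_distrib rate_def exp_of_nat_mult[symmetric]
        exp_add[symmetric] algebra_simps)
  define f where "f = (\<lambda>y. exp (- rate 0 1 * y) * expdiff (- \<theta>) y ^ n / fact n * expdiff \<eta> (t - y) ^ i)"
  have "chi (Suc n) i 0 t = integral {0..t} (\<lambda>y. f (t - y))"
    using chi_convolution[OF t, of n n i] unfolding eq by (simp add: f_def del: chi.simps(2,3))
  also have "\<dots> = integral {- 0..- (- t)} (\<lambda>y. (f \<circ> (+) t) (- y))" by simp
  also have "\<dots> = integral {- t..0} (f \<circ> (+) t)"
    by (rule Henstock_Kurzweil_Integration.integral_reflect_real)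
  also have "\<dots> = integral {0..t} f" by (subst integral_shift_Icc_real) simp
  finally show ?thesis by (simp add: f_def)
qed

end

section \<open>Joint law of last passage times\<close>

text \<open>Rows are counted from 0 and columns from 1, so that column 0 supplies the boundary value
  0. Truncating the weights at 0 makes nonnegativity and monotonicity in the row hold for every
  \<open>w\<close>, while the weights of interest are nonnegative only almost surely.\<close>

fun lpp :: "(cell \<Rightarrow> real) \<Rightarrow> nat \<Rightarrow> nat \<Rightarrow> real" where
  "lpp w k 0 = 0"
| "lpp w 0 (Suc n) = lpp w 0 n + max 0 (w (1, Suc n))"
| "lpp w (Suc k) (Suc n) = max (lpp w k (Suc n)) (lpp w (Suc k) n) + max 0 (w (Suc (Suc k), Suc n))"

lemma lpp_nonneg: "0 \<le> lpp w k n"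
  by (induction w k n rule: lpp.induct) auto

lemma lpp_mono_row: "k \<le> l \<Longrightarrow> lpp w k n \<le> lpp w l n"
proof (induction l rule: dec_induct)
  case (step l)
  have "lpp w l n \<le> lpp w (Suc l) n" by (cases n) auto
  with step.IH show ?case by linarith
qed simp

lemma lpp_cong:
  "(\<And>a b. a \<le> k \<Longrightarrow> 1 \<le> b \<Longrightarrow> b \<le> n \<Longrightarrow> w (Suc a, b) = w' (Suc a, b)) \<Longrightarrow> lpp w k n = lpp w' k n"
  by (induction w k n rule: lpp.induct) auto

lemma measurable_lpp:
  assumes "{1..Suc k} \<times> {1..n} \<subseteq> I" and "\<And>c. c \<in> I \<Longrightarrow> sets (\<mu> c) = sets borel"
  shows "(\<lambda>w. lpp w k n) \<in> borel_measurable (PiM I \<mu>)"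
  using assms(1)
proof (induction n arbitrary: k)
  case (Suc n)
  have comp: "(\<lambda>w. w c) \<in> borel_measurable (PiM I \<mu>)" if "c \<in> I" for c
    using measurable_component_singleton[OF that, of \<mu>] assms(2)[OF that]
      measurable_cong_sets[OF refl, of "\<mu> c" borel "PiM I \<mu>"] by simp
  from Suc.prems show ?case
  proof (induction k)
    case 0
    then have "{1..Suc 0} \<times> {1..n} \<subseteq> I" "(1, Suc n) \<in> I" by auto
    with Suc.IH[of 0] comp show ?case by simp
  next
    case (Suc k)
    then have "{1..Suc (Suc k)} \<times> {1..n} \<subseteq> I" "{1..Suc k} \<times> {1..Suc n} \<subseteq> I"
      "(Suc (Suc k), Suc n) \<in> I" by auto
    with Suc.IH \<open>\<And>k. {1..Suc k} \<times> {1..n} \<subseteq> I \<Longrightarrow> _\<close> comp show ?case by simp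
  qed
qed simp

text \<open>In state \<open>(n, k)\<close> the rows \<open>j < k\<close> (counted from 0) have already advanced to column \<open>n + 1\<close>.\<close>

definition level :: "nat \<Rightarrow> nat \<Rightarrow> nat \<Rightarrow> nat" where
  "level n k j = (if j < k then Suc n else n)"

text \<open>The thresholds before cell (k + 1, n + 1) receives its weight, where y is the threshold
  of row k minus that weight. The bound y on the maximum concerns rows k - 1 and k; monotonicity in
  the row extends it to all earlier rows, which keeps the thresholds nondecreasing when y is at most
  \<open>x k\<close>.\<close>

definition clip :: "(nat \<Rightarrow> real) \<Rightarrow> nat \<Rightarrow> real \<Rightarrow> nat \<Rightarrow> real" where
  "clip x k y j = (if j < k then min (x j) y else if j = k then y else x j)"

lemma lpp_update_less_iff:
  assumes k: "k < M" and s: "0 \<le> s"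
  shows "(\<forall>j<M. lpp (w((Suc k, Suc n) := s)) j (level n (Suc k) j) < x j) \<longleftrightarrow>
    (\<forall>j<M. lpp w j (level n k j) < clip x k (x k - s) j)"
proof -
  let ?w = "w((Suc k, Suc n) := s)"
  have other: "lpp ?w j (level n (Suc k) j) = lpp w j (level n k j)" if "j \<noteq> k" for j
    using that by (cases "j < k") (auto simp: level_def intro!: lpp_cong)
  have before: "lpp ?w k n = lpp w k n" by (rule lpp_cong) auto
  have diag: "lpp ?w k (level n (Suc k) k) < x k \<longleftrightarrow>
      lpp w k n < x k - s \<and> (\<forall>j<k. lpp w j (Suc n) < x k - s)"
  proof (cases k)
    case 0
    then show ?thesis using s before by (auto simp: level_def)
  next
    case (Suc l)
    have l: "lpp ?w l (Suc n) = lpp w l (Suc n)" using Suc by (intro lpp_cong) auto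
    have "lpp ?w k (level n (Suc k) k) = max (lpp w l (Suc n)) (lpp w k n) + s"
      using Suc s l before by (simp add: level_def)
    moreover have "(\<forall>j<k. lpp w j (Suc n) < x k - s) \<longleftrightarrow> lpp w l (Suc n) < x k - s"
      using Suc lpp_mono_row[of _ l w "Suc n"] by (force simp: less_Suc_eq_le intro: le_less_trans)
    ultimately show ?thesis by auto
  qed
  have "(\<forall>j<M. lpp ?w j (level n (Suc k) j) < x j) \<longleftrightarrow>
      lpp ?w k (level n (Suc k) k) < x k \<and> (\<forall>j<M. j \<noteq> k \<longrightarrow> lpp w j (level n k j) < x j)"
    using k by (metis other)
  also have "\<dots> \<longleftrightarrow> (\<forall>j<M. lpp w j (level n k j) < clip x k (x k - s) j)"
    unfolding diag using k by (auto simp: clip_def level_def)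
  finally show ?thesis .
qed

context arithmetic_rates
begin

definition chi_det :: "nat \<Rightarrow> nat \<Rightarrow> nat \<Rightarrow> (nat \<Rightarrow> real) \<Rightarrow> real" where
  "chi_det M n k x = fdet M (\<lambda>i j. chi (level n k j) i j (x j))"

text \<open>Differentiating column k gives the right-hand side. A column l < k with
  \<open>x l < y\<close> is locally constant. If \<open>y < x l\<close>, columns l and l + 1 both
  have argument y, because \<open>x\<close> is nondecreasing, and the derivative of column l is
  proportional to column l + 1: its determinant vanishes. This is the reflecting boundary
  condition.\<close>

lemma chi_det_clip_derivative:
  assumes k: "k < M" and y: "0 < y" "y < x k" and ne: "y \<notin> x ` {..<M}"
    and mono: "mono_on {..<M} x"
  shows "((\<lambda>y. chi_det M n (Suc k) (clip x k y)) has_real_derivative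
    chi_det M n k (clip x k y) - rate k (Suc n) * chi_det M n (Suc k) (clip x k y)) (at y)"
proof -
  let ?r = "rate k (Suc n)"
  define f where "f = (\<lambda>i j y. chi (level n (Suc k) j) i j (clip x k y j))"
  define f' where "f' = (\<lambda>i j. if j = k then chi n i k y - ?r * chi (Suc n) i k y
    else if j < k \<and> y < x j then real (Suc j) * exp (\<eta> * y) * chi (Suc n) i (Suc j) y else 0)"
  have at: "at y within {0..} = at y"
    using y by (intro at_within_interior) (simp add: interior_real_atLeast)
  have deriv: "(f i j has_real_derivative f' i j) (at y)" if "j < M" for i j
  proof -
    consider "j = k" | "j < k" "y < x j" | "j < k" "x j < y" | "j > k"
      using ne \<open>j < M\<close> by fastforce
    then show ?thesis
    proof cases
      case 1
      then show ?thesis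
        using chi_derivatives(2)[of y n i k] y at by (simp add: f_def f'_def level_def clip_def del: chi.simps)
    next
      case 2
      have "(chi (Suc n) i j has_real_derivative f' i j) (at y)"
        using chi_derivatives(1)[of y "Suc n" i j] y at 2 by (simp add: f'_def del: chi.simps)
      then show ?thesis
        by (rule has_field_derivative_transform_within_open[of _ _ _ "{..<x j}"])
           (use 2 in \<open>auto simp: f_def level_def clip_def simp del: chi.simps\<close>)
    next
      case 3
      have "((\<lambda>_. chi (Suc n) i j (x j)) has_real_derivative f' i j) (at y)"
        using 3 by (auto simp: f'_def)
      then show ?thesis
        by (rule has_field_derivative_transform_within_open[of _ _ _ "{x j<..}"])
           (use 3 in \<open>auto simp: f_def level_def clip_def simp del: chi.simps\<close>)
    next
      case 4
      then show ?thesis by (auto simp: f_def f'_def clip_def)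
    qed
  qed
  have "(\<Sum>l<M. fdet M (\<lambda>i j. if j = l then f' i j else f i j y)) =
      (\<Sum>l\<in>{k}. fdet M (\<lambda>i j. if j = l then f' i j else f i j y))"
  proof (intro sum.mono_neutral_right ballI)
    fix l assume l: "l \<in> {..<M} - {k}"
    show "fdet M (\<lambda>i j. if j = l then f' i j else f i j y) = 0"
    proof (cases "l < k \<and> y < x l")
      case True
      have "x l \<le> x (Suc l)" using mono True k by (intro mono_onD[OF mono]) auto
      then have "clip x k y (Suc l) = y" using True by (auto simp: clip_def)
      then show ?thesis
        using True k
        by (intro fdet_proportional_columns[of l M "Suc l" _ "real (Suc l) * exp (\<eta> * y)"])
           (auto simp: f'_def f_def level_def simp del: chi.simps)
    qed (use l in \<open>auto intro!: fdet_zero_column[of l] simp: f'_def\<close>)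
  qed (use k in auto)
  also have "\<dots> = fdet M (\<lambda>i j. if j = k then chi n i k y - ?r * chi (Suc n) i k y else f i j y)"
    by (simp, rule fdet_cong) (simp add: f'_def)
  also have "\<dots> = fdet M (\<lambda>i j. if j = k then chi n i k y else f i j y) -
      ?r * fdet M (\<lambda>i j. if j = k then chi (Suc n) i k y else f i j y)"
    by (rule fdet_column_diff[OF k])
  also have "fdet M (\<lambda>i j. if j = k then chi n i k y else f i j y) = chi_det M n k (clip x k y)"
    unfolding chi_det_def by (rule fdet_cong) (auto simp: f_def level_def clip_def simp del: chi.simps)
  also have "fdet M (\<lambda>i j. if j = k then chi (Suc n) i k y else f i j y) = chi_det M n (Suc k) (clip x k y)"
    unfolding chi_det_def by (rule fdet_cong) (auto simp: f_def level_def clip_def simp del: chi.simps)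
  finally show ?thesis
    using fdet_has_real_derivative[of M f f' y] deriv by (simp add: chi_det_def f_def)
qed

text \<open>Variation of constants with integrating factor
  \<open>exp (- rate k (Suc n) * s)\<close>. At \<open>s = x k\<close> column 0 has argument 0 and
  level n + 1, so it is an empty convolution and the determinant vanishes; at s = 0 the truncation
  does nothing.\<close>

lemma chi_det_has_integral:
  assumes k: "k < M" and x: "0 < x 0" and mono: "mono_on {..<M} x"
  shows "((\<lambda>s. exp (- rate k (Suc n) * s) * chi_det M n k (clip x k (x k - s))) has_integral
    chi_det M n (Suc k) x) {0..x k}"
proof -
  let ?r = "rate k (Suc n)"
  define H where "H = (\<lambda>y. chi_det M n (Suc k) (clip x k y))"
  have pos: "0 < x j" if "j < M" for j
    using x mono_onD[OF mono, of 0 j] that by simp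
  have "((\<lambda>s. exp (- ?r * s) * chi_det M n k (clip x k (x k - s))) has_integral
      - (exp (- ?r * x k) * H (x k - x k)) - - (exp (- ?r * 0) * H (x k - 0))) {0..x k}"
  \<comment> \<open>The finitely many excluded s are those where \<open>x k - s\<close> meets some
    \<open>x j\<close>, a possible kink of the minimum in \<open>clip\<close>.\<close>
  proof (rule fundamental_theorem_of_calculus_interior_strong[where S = "(\<lambda>z. x k - z) ` x ` {..<M}"])
    show "0 \<le> x k" using pos[OF k] by simp
  next
    fix s assume s: "s \<in> {0<..<x k} - (\<lambda>z. x k - z) ` x ` {..<M}"
    have "x k - s \<notin> x ` {..<M}"
    proof
      assume "x k - s \<in> x ` {..<M}"
      then have "x k - (x k - s) \<in> (\<lambda>z. x k - z) ` x ` {..<M}" by (rule imageI)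
      then show False using s by simp
    qed
    then have D: "(H has_real_derivative chi_det M n k (clip x k (x k - s)) - ?r * H (x k - s)) (at (x k - s))"
      unfolding H_def using s by (intro chi_det_clip_derivative k mono) auto
    have "((\<lambda>s. - (exp (- ?r * s) * H (x k - s))) has_real_derivative
        exp (- ?r * s) * chi_det M n k (clip x k (x k - s))) (at s)"
      by (rule derivative_eq_intros DERIV_chain2[where g = "\<lambda>s. x k - s", OF D] refl)+ (simp add: algebra_simps)
    then show "((\<lambda>s. - (exp (- ?r * s) * H (x k - s))) has_vector_derivative
        exp (- ?r * s) * chi_det M n k (clip x k (x k - s))) (at s)"
      by (simp add: has_real_derivative_iff_has_vector_derivative)
  next
    have clip_cont: "continuous_on S (\<lambda>s. clip x k (x k - s) j)" for j S
      unfolding clip_def by (cases "j < k"; cases "j = k") (auto intro!: continuous_intros)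
    have clip_nonneg: "0 \<le> clip x k (x k - s) j" if "s \<in> {0..x k}" "j < M" for s j
      using that pos[of j] by (auto simp: clip_def)
    show "continuous_on {0..x k} (\<lambda>s. - (exp (- ?r * s) * H (x k - s)))"
      unfolding H_def chi_det_def
      by (intro continuous_intros continuous_on_fdet
          continuous_on_compose2[OF continuous_on_chi] clip_cont)
         (use clip_nonneg in auto)
  qed simp
  moreover have "H 0 = 0"
    unfolding H_def chi_det_def
    by (rule fdet_zero_column[of 0]) (use k pos[of 0] in \<open>auto simp: level_def clip_def\<close>)
  moreover have "H (x k) = chi_det M n (Suc k) x"
  proof -
    have "clip x k (x k) j = x j" if "j < M" for j
      using that k mono_onD[OF mono, of j k] by (auto simp: clip_def)
    then show ?thesis unfolding H_def chi_det_def by (intro fdet_cong) simp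
  qed
  ultimately show ?thesis by simp
qed

text \<open>Outside the relevant range, where \<^term>\<open>rate\<close> may fail to be positive, the value 1 merely keeps
  every factor of the product measure a probability measure.\<close>

definition cell_rate :: "cell \<Rightarrow> real" where
  "cell_rate c = (if 0 < rate (fst c - 1) (snd c) then rate (fst c - 1) (snd c) else 1)"

definition cell_law :: "cell \<Rightarrow> real measure" where
  "cell_law c = density lborel (exponential_density (cell_rate c))"

definition cells :: "nat \<Rightarrow> nat \<Rightarrow> nat \<Rightarrow> cell set" where
  "cells M n k = {1..M} \<times> {1..n} \<union> {1..k} \<times> {Suc n}"

lemma cell_rate_pos: "0 < cell_rate c"
  by (simp add: cell_rate_def)

lemma prob_space_cell_law: "prob_space (cell_law c)"
  unfolding cell_law_def by (intro prob_space_exponential_density cell_rate_pos)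

lemma sets_cell_law [simp, measurable_cong]: "sets (cell_law c) = sets borel"
  by (simp add: cell_law_def)

lemma product_prob_space_cell_law: "product_prob_space cell_law"
  by (rule product_prob_spaceI) (rule prob_space_cell_law)

lemma cells_Suc: "cells M n (Suc k) = insert (Suc k, Suc n) (cells M n k)"
  by (auto simp: cells_def le_Suc_eq)

lemma finite_cells [simp]: "finite (cells M n k)"
  by (simp add: cells_def)

lemma measurable_lpp_cells:
  assumes "k \<le> M" "j < M"
  shows "(\<lambda>w. lpp w j (level n k j)) \<in> borel_measurable (PiM (cells M n k) cell_law)"
  by (rule measurable_lpp) (use assms in \<open>auto simp: cells_def level_def\<close>)

lemma measurable_lpp_event:
  assumes "k \<le> M"
  shows "{w \<in> space (PiM (cells M n k) cell_law). \<forall>j<M. lpp w j (level n k j) < x j} \<in>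
    sets (PiM (cells M n k) cell_law)"
proof -
  have "{w \<in> space (PiM (cells M n k) cell_law). \<forall>j\<in>{..<M}. lpp w j (level n k j) < x j} \<in>
      sets (PiM (cells M n k) cell_law)"
  proof (rule sets.sets_Collect_finite_All)
    fix j assume "j \<in> {..<M}"
    then show "{w \<in> space (PiM (cells M n k) cell_law). lpp w j (level n k j) < x j} \<in>
        sets (PiM (cells M n k) cell_law)"
      by (intro borel_measurable_less measurable_lpp_cells assms) simp_all
  qed simp
  then show ?thesis by (simp only: Ball_def lessThan_iff)
qed

text \<open>Each new weight is independent of the cells already used, so the new probability is the
  integral over its value s of the earlier probability at clipped thresholds. This is the integral
  in \<open>chi_det_has_integral\<close>. Clipping preserves monotonicity, hence the induction stays
  within nondecreasing thresholds.\<close>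

lemma lpp_joint_distribution:
  assumes rate_pos: "\<And>k n. k < M \<Longrightarrow> 1 \<le> n \<Longrightarrow> n \<le> N \<Longrightarrow> 0 < rate k n" and M: "0 < M"
  shows "n < N \<Longrightarrow> k \<le> M \<Longrightarrow> 0 < x 0 \<Longrightarrow> mono_on {..<M} x \<Longrightarrow>
    measure (PiM (cells M n k) cell_law)
      {w \<in> space (PiM (cells M n k) cell_law). \<forall>j<M. lpp w j (level n k j) < x j} =
    (\<Prod>c\<in>cells M n k. cell_rate c) * chi_det M n k x"
proof (induction n arbitrary: k x)
  have step: "measure (PiM (cells M n (Suc k)) cell_law)
      {w \<in> space (PiM (cells M n (Suc k)) cell_law). \<forall>j<M. lpp w j (level n (Suc k) j) < x j} =
      (\<Prod>c\<in>cells M n (Suc k). cell_rate c) * chi_det M n (Suc k) x"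
    if IH: "\<And>x. 0 < x 0 \<Longrightarrow> mono_on {..<M} x \<Longrightarrow> measure (PiM (cells M n k) cell_law)
        {w \<in> space (PiM (cells M n k) cell_law). \<forall>j<M. lpp w j (level n k j) < x j} =
        (\<Prod>c\<in>cells M n k. cell_rate c) * chi_det M n k x"
      and n: "n < N" and k: "Suc k \<le> M" and x: "0 < x 0" and mono: "mono_on {..<M} x" for n k x
  proof -
    let ?c = "(Suc k, Suc n)" and ?r = "rate k (Suc n)"
    let ?Q = "PiM (cells M n k) cell_law" and ?Q' = "PiM (cells M n (Suc k)) cell_law"
    define A where "A = (\<lambda>x. {w \<in> space ?Q. \<forall>j<M. lpp w j (level n k j) < x j})"
    define A' where "A' = {w \<in> space ?Q'. \<forall>j<M. lpp w j (level n (Suc k) j) < x j}"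
    let ?C = "\<Prod>c\<in>cells M n k. cell_rate c"
    interpret product_prob_space cell_law by (rule product_prob_space_cell_law)
    interpret Q: prob_space ?Q by (rule prob_space_PiM) (rule prob_space_cell_law)
    interpret Q': prob_space ?Q' by (rule prob_space_PiM) (rule prob_space_cell_law)
    have r: "cell_rate ?c = ?r" "0 < ?r" using rate_pos[of k "Suc n"] n k by (auto simp: cell_rate_def)
    have fresh: "?c \<notin> cells M n k" by (auto simp: cells_def)
    have A_sets: "A y \<in> sets ?Q" for y unfolding A_def by (rule measurable_lpp_event) (use k in simp)
    have A'_sets: "A' \<in> sets ?Q'" unfolding A'_def by (rule measurable_lpp_event[OF k])
    have xk: "0 < x k" using x mono_onD[OF mono, of 0 k] k by simp
    have inner: "(\<integral>\<^sup>+w. indicator A' (w(?c := s)) \<partial>?Q) = emeasure ?Q (A (clip x k (x k - s)))"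
      if "0 \<le> s" for s
    proof -
      have "(\<integral>\<^sup>+w. indicator A' (w(?c := s)) \<partial>?Q) =
          (\<integral>\<^sup>+w. indicator (A (clip x k (x k - s))) w \<partial>?Q)"
      proof (rule nn_integral_cong)
        fix w assume w: "w \<in> space ?Q"
        have "w(?c := s) \<in> space ?Q'"
          using w unfolding cells_Suc space_PiM by (intro PiE_fun_upd) (simp_all add: cell_law_def)
        moreover have "(\<forall>j<M. lpp (w(?c := s)) j (level n (Suc k) j) < x j) \<longleftrightarrow>
            (\<forall>j<M. lpp w j (level n k j) < clip x k (x k - s) j)"
          by (rule lpp_update_less_iff) (use k \<open>0 \<le> s\<close> in simp_all)
        ultimately have "w(?c := s) \<in> A' \<longleftrightarrow> w \<in> A (clip x k (x k - s))"
          using w unfolding A_def A'_def by blast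
        then show "indicator A' (w(?c := s)) = (indicator (A (clip x k (x k - s))) w :: ennreal)"
          by (simp only: indicator_def)
      qed
      then show ?thesis using nn_integral_indicator[OF A_sets] by (simp only:)
    qed
    define f where "f = (\<lambda>s. ?r * ?C * (exp (- ?r * s) * chi_det M n k (clip x k (x k - s))))"
    have f: "ennreal (exponential_density ?r s) * emeasure ?Q (A (clip x k (x k - s))) = ennreal (f s)"
      "0 \<le> f s" if s: "s \<in> {0<..<x k}" for s
    proof -
      have "mono_on {..<M} (clip x k (x k - s))"
      proof (rule mono_onI)
        fix i j assume "i \<in> {..<M}" "j \<in> {..<M}" "i \<le> j"
        then show "clip x k (x k - s) i \<le> clip x k (x k - s) j"
          using mono_onD[OF mono, of i j] mono_onD[OF mono, of k j] s k by (auto simp: clip_def)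
      qed
      moreover have "0 < clip x k (x k - s) 0" using x s by (auto simp: clip_def)
      ultimately have m: "measure ?Q (A (clip x k (x k - s))) = ?C * chi_det M n k (clip x k (x k - s))"
        unfolding A_def by (rule IH[rotated])
      have eq: "f s = exponential_density ?r s * measure ?Q (A (clip x k (x k - s)))"
        unfolding m f_def exponential_density_def using s by (simp add: mult_ac)
      have d: "0 \<le> exponential_density ?r s" using r by (simp add: exponential_density_def)
      show "0 \<le> f s" unfolding eq using d by simp
      show "ennreal (exponential_density ?r s) * emeasure ?Q (A (clip x k (x k - s))) = ennreal (f s)"
        unfolding eq Q.emeasure_eq_measure using d by (simp add: ennreal_mult)
    qed
    have mint: "(\<lambda>s. \<integral>\<^sup>+w. indicator A' (w(?c := s)) \<partial>?Q) \<in> borel_measurable lborel"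
    proof -
      have "(\<lambda>(s, w). w(?c := s)) \<in> measurable (cell_law ?c \<Otimes>\<^sub>M ?Q) ?Q'"
        unfolding cells_Suc using measurable_comp[OF measurable_pair_swap' measurable_add_dim]
        by (simp add: comp_def case_prod_beta')
      then have "(\<lambda>(s, w). indicator A' (w(?c := s)) :: ennreal) \<in> borel_measurable (cell_law ?c \<Otimes>\<^sub>M ?Q)"
        using measurable_compose[OF _ borel_measurable_indicator[OF A'_sets]]
        by (simp add: case_prod_beta')
      from Q.borel_measurable_nn_integral[OF this]
      show ?thesis by (simp cong: measurable_cong_sets)
    qed
    have "emeasure ?Q' A' = (\<integral>\<^sup>+w. indicator A' w \<partial>?Q')"
      by (rule nn_integral_indicator[OF A'_sets, symmetric])
    also have "\<dots> = (\<integral>\<^sup>+s. (\<integral>\<^sup>+w. indicator A' (w(?c := s)) \<partial>?Q) \<partial>cell_law ?c)"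
      using A'_sets fresh unfolding cells_Suc
      by (intro product_nn_integral_insert_rev) auto
    also have "\<dots> = (\<integral>\<^sup>+s. ennreal (exponential_density ?r s) *
        (\<integral>\<^sup>+w. indicator A' (w(?c := s)) \<partial>?Q) \<partial>lborel)"
      unfolding cell_law_def[of ?c] r
      by (rule nn_integral_density) (use mint in simp_all)
    also have "\<dots> = (\<integral>\<^sup>+s. ennreal (indicator {0<..<x k} s * f s) \<partial>lborel)"
    proof (rule nn_integral_cong_AE)
      \<comment> \<open>At \<open>s = x k\<close> the first threshold is 0, where the induction
        hypothesis says nothing. Beyond it the event is empty, and for negative s the density is
        0.\<close>
      have "AE s in lborel. s \<noteq> 0 \<and> s \<noteq> x k"
        using AE_lborel_singleton[of 0] AE_lborel_singleton[of "x k"] by eventually_elim simp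
      then show "AE s in lborel. ennreal (exponential_density ?r s) *
          (\<integral>\<^sup>+w. indicator A' (w(?c := s)) \<partial>?Q) = ennreal (indicator {0<..<x k} s * f s)"
      proof eventually_elim
        case (elim s)
        consider "s < 0" | "s \<in> {0<..<x k}" | "x k < s" using elim by fastforce
        then show ?case
        proof cases
          case 1
          then show ?thesis by (simp add: exponential_density_def)
        next
          case 2
          then show ?thesis using f[OF 2] by (simp add: inner)
        next
          case 3
          have "A (clip x k (x k - s)) = {}"
          proof -
            have "\<not> lpp w k (level n k k) < clip x k (x k - s) k" for w
              using 3 lpp_nonneg[of w k "level n k k"] by (simp add: clip_def)
            then show ?thesis using k unfolding A_def by (auto simp: Suc_le_eq)
          qed
          then show ?thesis using 3 xk by (simp add: inner)
        qed
      qed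
    qed
    also have "\<dots> = ennreal (?r * ?C * chi_det M n (Suc k) x)"
    proof (rule nn_integral_has_integral_lebesgue)
      show "(f has_integral ?r * ?C * chi_det M n (Suc k) x) {0<..<x k}"
        unfolding f_def has_integral_Icc_iff_Ioo[symmetric]
        by (intro has_integral_mult_right chi_det_has_integral x mono) (use k in simp)
    qed (use f in auto)
    also have "?r * ?C = (\<Prod>c\<in>cells M n (Suc k). cell_rate c)"
      using fresh r by (simp add: cells_Suc)
    finally have em: "emeasure ?Q' A' = ennreal ((\<Prod>c\<in>cells M n (Suc k). cell_rate c) * chi_det M n (Suc k) x)" .
    \<comment> \<open>Nonnegativity is what allows the real value to be recovered from the equation
      between extended nonnegative numbers.\<close>
    have "0 \<le> ?r * ?C * chi_det M n (Suc k) x"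
    proof (rule has_integral_nonneg)
      show "(f has_integral ?r * ?C * chi_det M n (Suc k) x) {0<..<x k}"
        unfolding f_def has_integral_Icc_iff_Ioo[symmetric]
        by (intro has_integral_mult_right chi_det_has_integral x mono) (use k in simp)
    qed (use f in auto)
    then have "0 \<le> (\<Prod>c\<in>cells M n (Suc k). cell_rate c) * chi_det M n (Suc k) x"
      using fresh r by (simp add: cells_Suc)
    then show ?thesis using em unfolding A'_def by (simp add: measure_def)
  qed
  have inner: "measure (PiM (cells M n k) cell_law)
      {w \<in> space (PiM (cells M n k) cell_law). \<forall>j<M. lpp w j (level n k j) < x j} =
      (\<Prod>c\<in>cells M n k. cell_rate c) * chi_det M n k x"
    if base: "\<And>x. 0 < x 0 \<Longrightarrow> mono_on {..<M} x \<Longrightarrow> measure (PiM (cells M n 0) cell_law)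
        {w \<in> space (PiM (cells M n 0) cell_law). \<forall>j<M. lpp w j (level n 0 j) < x j} =
        (\<Prod>c\<in>cells M n 0. cell_rate c) * chi_det M n 0 x"
      and "n < N" "k \<le> M" "0 < x 0" "mono_on {..<M} x" for n k x
    using that(3-)
  proof (induction k arbitrary: x)
    case (Suc k)
    then show ?case using step[of n k x] \<open>n < N\<close> by simp
  qed (rule base)
  {
    case 0
    have "measure (PiM (cells M 0 0) cell_law)
        {w \<in> space (PiM (cells M 0 0) cell_law). \<forall>j<M. lpp w j (level 0 0 j) < x j} =
        (\<Prod>c\<in>cells M 0 0. cell_rate c) * chi_det M 0 0 x"
      if x: "0 < x 0" "mono_on {..<M} x" for x
    proof -
      interpret Q: prob_space "PiM (cells M 0 0) cell_law"
        by (rule prob_space_PiM) (rule prob_space_cell_law)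
      have "0 < x j" if "j < M" for j using x mono_onD[OF x(2), of 0 j] that by simp
      then have "{w \<in> space (PiM (cells M 0 0) cell_law). \<forall>j<M. lpp w j (level 0 0 j) < x j} =
          space (PiM (cells M 0 0) cell_law)" by (auto simp: level_def)
      \<comment> \<open>At level 0 the entry (i, j) contains \<open>i choose j\<close>, so the
        matrix is lower triangular with unit diagonal.\<close>
      moreover have "chi_det M 0 0 x = 1"
        unfolding chi_det_def by (subst fdet_lower_triangular) (auto simp: level_def)
      moreover have "cells M 0 0 = {}" by (auto simp: cells_def)
      ultimately show ?thesis using Q.prob_space by simp
    qed
    then show ?case using inner[of 0 k x] 0 by blast
  next
    case (Suc n)
    have "measure (PiM (cells M (Suc n) 0) cell_law)
        {w \<in> space (PiM (cells M (Suc n) 0) cell_law). \<forall>j<M. lpp w j (level (Suc n) 0 j) < x j} =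
        (\<Prod>c\<in>cells M (Suc n) 0. cell_rate c) * chi_det M (Suc n) 0 x"
      if x: "0 < x 0" "mono_on {..<M} x" for x
    proof -
      \<comment> \<open>A completed column is the start of the next: states (n, M) and (n + 1, 0)
        have the same cells, the same levels and the same determinant.\<close>
      have "cells M (Suc n) 0 = cells M n M" by (auto simp: cells_def le_Suc_eq)
      moreover have lev: "level (Suc n) 0 j = level n M j" if "j < M" for j using that by (simp add: level_def)
      moreover have "chi_det M (Suc n) 0 x = chi_det M n M x"
        unfolding chi_det_def by (rule fdet_cong) (simp add: lev)
      moreover have "(\<forall>j<M. lpp w j (level (Suc n) 0 j) < x j) \<longleftrightarrow> (\<forall>j<M. lpp w j (level n M j) < x j)" for w
        using lev by simp
      ultimately show ?thesis using Suc.IH[of M x] Suc.prems x by simp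
    qed
    then show ?case using inner[of "Suc n" k x] Suc.prems by blast
  }
qed

end

section \<open>From last passage times to the ensemble\<close>

lemma expdiff_minus_minus: "expdiff (- s) (- x) = - expdiff s x"
  by (simp add: expdiff_def)

lemma expdiff_ln_diff:
  assumes "0 < a" "0 < b"
  shows "expdiff s (ln b) - expdiff s (ln a) = (if s = 0 then 1 else 1 / s) * power_difference s a b"
  using assms by (simp add: expdiff_def power_difference_def powr_def diff_divide_distrib)

context arithmetic_rates
begin

text \<open>Unrolling the third clause of \<open>chi\<close> at a fixed t reaches only functions
  with index k = 0 at levels n - j. The coefficients do not depend on i, so this is a triangular
  column operation; only its diagonal coefficient will matter.\<close>

lemma chi_columns:
  assumes "k \<le> n"
  shows "\<exists>c. c k = exp (- \<eta> * t) ^ k / fact k \<and> (\<forall>j>k. c j = 0) \<and>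
    (\<forall>i. chi n i k t = (\<Sum>j\<le>k. c j * chi (n - j) i 0 t))"
  using assms
proof (induction k arbitrary: n)
  case 0
  show ?case by (intro exI[of _ "\<lambda>j. if j = 0 then 1 else 0"]) simp
next
  case (Suc k)
  then obtain m where m: "n = Suc m" "k \<le> m" by (cases n) auto
  obtain a where a: "a k = exp (- \<eta> * t) ^ k / fact k" "\<forall>j>k. a j = 0"
    "\<And>i. chi m i k t = (\<Sum>j\<le>k. a j * chi (m - j) i 0 t)" using Suc.IH[OF m(2)] by blast
  obtain b where b: "\<forall>j>k. b j = 0" "\<And>i. chi n i k t = (\<Sum>j\<le>k. b j * chi (n - j) i 0 t)"
    using Suc.IH[of n] Suc.prems by (auto simp del: chi.simps)
  define c where "c = (\<lambda>j. exp (- \<eta> * t) / real (Suc k) * ((case j of 0 \<Rightarrow> 0 | Suc l \<Rightarrow> a l) - rate k n * b j))"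
  have "chi n i (Suc k) t = (\<Sum>j\<le>Suc k. c j * chi (n - j) i 0 t)" for i
  proof -
    have "(\<Sum>j\<le>Suc k. c j * chi (n - j) i 0 t) = exp (- \<eta> * t) / real (Suc k) *
        ((\<Sum>j\<le>Suc k. (case j of 0 \<Rightarrow> 0 | Suc l \<Rightarrow> a l) * chi (n - j) i 0 t) -
          rate k n * (\<Sum>j\<le>Suc k. b j * chi (n - j) i 0 t))"
      by (simp only: c_def sum_distrib_left sum_subtractf[symmetric]) (simp add: algebra_simps)
    also have "(\<Sum>j\<le>Suc k. (case j of 0 \<Rightarrow> 0 | Suc l \<Rightarrow> a l) * chi (n - j) i 0 t) = chi m i k t"
      unfolding sum.atMost_Suc_shift a(3) using m by (simp del: chi.simps)
    also have "(\<Sum>j\<le>Suc k. b j * chi (n - j) i 0 t) = chi n i k t"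
      unfolding b(2) using b(1) by (simp del: chi.simps)
    finally show ?thesis using m by simp
  qed
  moreover have "c (Suc k) = exp (- \<eta> * t) ^ Suc k / fact (Suc k)"
    using a(1) b(1) by (simp add: c_def)
  moreover have "\<forall>j>Suc k. c j = 0"
    using a(2) b(1) by (auto simp: c_def split: nat.split)
  ultimately show ?case by blast
qed

definition chi_moment :: "nat \<Rightarrow> nat \<Rightarrow> real \<Rightarrow> real" where
  "chi_moment m n t = integral {0..t}
    (\<lambda>y. exp (- rate 0 1 * y) * expdiff (- \<theta>) y ^ n * expdiff \<eta> (- y) ^ m)"

text \<open>The addition law \<open>expdiff_diff\<close> and the binomial theorem separate t from
  the integration variable. The resulting row operation is lower triangular with diagonal
  \<open>exp (\<eta> * t) ^ i\<close>.\<close>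

lemma chi_rows:
  assumes "0 \<le> t"
  shows "chi (Suc n) i 0 t = (\<Sum>m\<le>i. real (i choose m) * exp (\<eta> * t) ^ m * expdiff \<eta> t ^ (i - m) *
    (1 / fact n * chi_moment m n t))"
proof -
  let ?E = "\<lambda>y. exp (- rate 0 1 * y) * expdiff (- \<theta>) y ^ n"
  let ?b = "\<lambda>m. real (i choose m) * exp (\<eta> * t) ^ m * expdiff \<eta> t ^ (i - m) / fact n"
  have expand: "?E y / fact n * expdiff \<eta> (t - y) ^ i = (\<Sum>m\<le>i. ?b m * (?E y * expdiff \<eta> (- y) ^ m))" for y
    unfolding expdiff_diff[of \<eta> t y] binomial_ring[of "exp (\<eta> * t) * expdiff \<eta> (- y)"  "expdiff \<eta> t" i,
        unfolded add.commute[of "exp (\<eta> * t) * expdiff \<eta> (- y)"]]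
    by (simp add: sum_distrib_left power_mult_distrib mult_ac)
  have "chi (Suc n) i 0 t = integral {0..t} (\<lambda>y. \<Sum>m\<le>i. ?b m * (?E y * expdiff \<eta> (- y) ^ m))"
    unfolding chi_eq_integral[OF assms] expand ..
  also have "\<dots> = (\<Sum>m\<le>i. integral {0..t} (\<lambda>y. ?b m * (?E y * expdiff \<eta> (- y) ^ m)))"
    by (intro integral_sum integrable_continuous_real continuous_intros) auto
  also have "\<dots> = (\<Sum>m\<le>i. real (i choose m) * exp (\<eta> * t) ^ m * expdiff \<eta> t ^ (i - m) *
      (1 / fact n * chi_moment m n t))"
    by (simp add: chi_moment_def)
  finally show ?thesis .
qed

text \<open>The diagonals of the row and column operations contribute inverse powers of
  \<open>exp (\<eta> * t)\<close>. Their cancellation is essential: the factor left over must be the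
  same for every threshold t.\<close>

lemma fdet_chi:
  assumes M: "M \<le> N" and t: "0 \<le> t"
  shows "fdet M (\<lambda>i j. chi N i j t) =
    (\<Prod>j<M. 1 / (fact j * fact (N - 1 - j))) * fdet M (\<lambda>m j. chi_moment m (N - 1 - j) t)"
proof -
  have "\<exists>c. \<forall>k. k \<le> N \<longrightarrow> c k k = exp (- \<eta> * t) ^ k / fact k \<and> (\<forall>j>k. c k j = 0) \<and>
      (\<forall>i. chi N i k t = (\<Sum>j\<le>k. c k j * chi (N - j) i 0 t))"
    by (intro choice allI) (use chi_columns in blast)
  then obtain c where c: "\<And>k. k \<le> N \<Longrightarrow> c k k = exp (- \<eta> * t) ^ k / fact k"
      "\<And>k j. k \<le> N \<Longrightarrow> k < j \<Longrightarrow> c k j = 0"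
      "\<And>k i. k \<le> N \<Longrightarrow> chi N i k t = (\<Sum>j\<le>k. c k j * chi (N - j) i 0 t)" by blast
  let ?T = "\<lambda>i m. real (i choose m) * exp (\<eta> * t) ^ m * expdiff \<eta> t ^ (i - m)"
  have "fdet M (\<lambda>i k. chi N i k t) = fdet M (\<lambda>i k. \<Sum>j<M. chi (N - j) i 0 t * c k j)"
  proof (rule fdet_cong)
    fix i k assume k: "k < M"
    have "chi N i k t = (\<Sum>j\<le>k. chi (N - j) i 0 t * c k j)"
      using c(3)[of k i] k M by (simp add: mult.commute del: chi.simps)
    also have "\<dots> = (\<Sum>j<M. chi (N - j) i 0 t * c k j)"
      using c(2)[of k] k M by (intro sum.mono_neutral_left) auto
    finally show "chi N i k t = (\<Sum>j<M. chi (N - j) i 0 t * c k j)" .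
  qed
  also have "\<dots> = fdet M (\<lambda>i j. chi (N - j) i 0 t) * fdet M (\<lambda>j k. c k j)"
    by (rule fdet_mult)
  also have "fdet M (\<lambda>j k. c k j) = (\<Prod>k<M. exp (- \<eta> * t) ^ k / fact k)"
    using c(1,2) M by (subst fdet_upper_triangular) auto
  also have "fdet M (\<lambda>i j. chi (N - j) i 0 t) =
      fdet M (\<lambda>i j. \<Sum>m<M. ?T i m * (1 / fact (N - 1 - j) * chi_moment m (N - 1 - j) t))"
  proof (rule fdet_cong)
    fix i j assume ij: "i < M" "j < M"
    then have N: "N - j = Suc (N - 1 - j)" using M by simp
    have "(\<Sum>m\<le>i. ?T i m * (1 / fact (N - 1 - j) * chi_moment m (N - 1 - j) t)) =
        (\<Sum>m<M. ?T i m * (1 / fact (N - 1 - j) * chi_moment m (N - 1 - j) t))"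
      using ij by (intro sum.mono_neutral_left) auto
    then show "chi (N - j) i 0 t = (\<Sum>m<M. ?T i m * (1 / fact (N - 1 - j) * chi_moment m (N - 1 - j) t))"
      unfolding N chi_rows[OF t] by simp
  qed
  also have "\<dots> = fdet M ?T * fdet M (\<lambda>m j. 1 / fact (N - 1 - j) * chi_moment m (N - 1 - j) t)"
    by (rule fdet_mult)
  also have "fdet M ?T = (\<Prod>i<M. exp (\<eta> * t) ^ i)"
    by (subst fdet_lower_triangular) auto
  also have "fdet M (\<lambda>m j. 1 / fact (N - 1 - j) * chi_moment m (N - 1 - j) t) =
      (\<Prod>j<M. 1 / fact (N - 1 - j)) * fdet M (\<lambda>m j. chi_moment m (N - 1 - j) t)"
    by (rule fdet_scale_columns)
  also have "(\<Prod>i<M. exp (\<eta> * t) ^ i) * ((\<Prod>j<M. 1 / fact (N - 1 - j)) * fdet M (\<lambda>m j. chi_moment m (N - 1 - j) t)) *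
      (\<Prod>k<M. exp (- \<eta> * t) ^ k / fact k) =
      (\<Prod>k<M. exp (\<eta> * t) ^ k * (1 / fact (N - 1 - k)) * (exp (- \<eta> * t) ^ k / fact k)) *
      fdet M (\<lambda>m j. chi_moment m (N - 1 - j) t)"
    unfolding prod.distrib by (simp only: mult_ac)
  also have "(\<Prod>k<M. exp (\<eta> * t) ^ k * (1 / fact (N - 1 - k)) * (exp (- \<eta> * t) ^ k / fact k)) =
      (\<Prod>j<M. 1 / (fact j * fact (N - 1 - j)))"
  proof (rule prod.cong)
    fix k
    have "exp (\<eta> * t) ^ k * exp (- \<eta> * t) ^ k = 1"
      by (simp add: power_mult_distrib[symmetric] exp_minus)
    then show "exp (\<eta> * t) ^ k * (1 / fact (N - 1 - k)) * (exp (- \<eta> * t) ^ k / fact k) =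
        1 / (fact k * fact (N - 1 - k))" by (simp add: field_simps)
  qed simp
  finally show ?thesis .
qed

lemma chi_moment_substitution:
  assumes s: "0 < s" "s < 1"
  shows "chi_moment m n (- ln s) =
    integral {s..1} (\<lambda>x. expdiff \<eta> (ln x) ^ m * (x powr (rate 0 1 - 1) * (- expdiff \<theta> (ln x)) ^ n))"
proof -
  define f where "f = (\<lambda>x. expdiff \<eta> (ln x) ^ m * (x powr (rate 0 1 - 1) * (- expdiff \<theta> (ln x)) ^ n))"
  have cont: "continuous_on {s..1} f"
    unfolding f_def using s by (auto intro!: continuous_intros)
  have "((\<lambda>y. - exp (- y) *\<^sub>R f (exp (- y))) has_integral
      (integral {exp (- 0)..exp (- (- ln s))} f - integral {exp (- (- ln s))..exp (- 0)} f)) {0..- ln s}"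
  proof (rule has_integral_substitution_general[where c = s and d = 1 and s = "{}"])
    show "(\<lambda>y. exp (- y)) ` {0..- ln s} \<subseteq> {s..1}"
    proof (intro image_subsetI)
      fix y assume y: "y \<in> {0..- ln s}"
      then have "exp (ln s) \<le> exp (- y)" by (subst exp_le_cancel_iff) simp
      then show "exp (- y) \<in> {s..1}" using s y by simp
    qed
  qed (use s cont in \<open>auto intro!: derivative_eq_intros continuous_intros\<close>)
  moreover have "- exp (- y) *\<^sub>R f (exp (- y)) =
      - (exp (- rate 0 1 * y) * expdiff (- \<theta>) y ^ n * expdiff \<eta> (- y) ^ m)" for y
  proof -
    have "exp (- y) * exp (- y) powr (rate 0 1 - 1) = exp (- rate 0 1 * y)"
      by (simp add: powr_def exp_add[symmetric] algebra_simps)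
    then show ?thesis
      using expdiff_minus_minus[of \<theta> "- y"] by (simp add: f_def mult_ac)
  qed
  ultimately have "((\<lambda>y. - (exp (- rate 0 1 * y) * expdiff (- \<theta>) y ^ n * expdiff \<eta> (- y) ^ m)) has_integral
      - integral {s..1} f) {0..- ln s}"
    using s by simp
  then show ?thesis
    unfolding has_integral_neg_iff chi_moment_def f_def by (simp add: integral_unique)
qed

end

section \<open>Vandermonde form of the ensemble weight\<close>

lemma prod_triangle_scale:
  "(\<Prod>j<M. \<Prod>i<j. a * F i j) = (\<Prod>j<M. \<Prod>i<j. a :: real) * (\<Prod>j<M. \<Prod>i<j. F i j)"
  by (simp only: prod.distrib)

lemma fdet_vandermonde_reversed:
  "\<exists>\<epsilon>. \<forall>y. fdet n (\<lambda>i j. y j ^ (n - 1 - i)) = \<epsilon> * (\<Prod>j<n. \<Prod>i<j. y j - y i :: real)"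
proof -
  define p where "p = (\<lambda>i. if i < n then n - 1 - i else i)"
  have "bij_betw p {0..<n} {0..<n}"
    by (rule bij_betw_byWitness[where f' = p]) (auto simp: p_def)
  then have p: "p permutes {0..<n}" by (rule bij_imp_permutes) (simp add: p_def)
  have "fdet n (\<lambda>i j. y j ^ (n - 1 - i)) = signof p * (\<Prod>j<n. \<Prod>i<j. y j - y i)" for y :: "nat \<Rightarrow> real"
  proof -
    have "fdet n (\<lambda>i j. y j ^ (n - 1 - i)) = fdet n (\<lambda>i j. y j ^ p i)"
      by (rule fdet_cong) (simp add: p_def)
    also have "\<dots> = signof p * fdet n (\<lambda>i j. y j ^ i)"
      by (rule fdet_permute_rows[OF p])
    finally show ?thesis by (simp add: fdet_vandermonde)
  qed
  then show ?thesis by blast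
qed

text \<open>All exponents N - 1 - i are at least N - M, so the power N - M comes out of each column
  and a reversed Vandermonde determinant remains. Differences of \<open>expdiff\<close> at
  logarithms are constant multiples of \<open>power_difference\<close>, both being logarithmic at
  parameter 0. \<open>K\<close> collects these constants and the sign of the reversal, independently
  of the points.\<close>

lemma ensemble_weight_eq_fdet:
  assumes "M \<le> N"
  shows "\<exists>K. \<forall>x. (\<forall>j<M. 0 < x j) \<longrightarrow>
    fdet M (\<lambda>i j. expdiff \<eta> (ln (x j)) ^ i) *
    fdet M (\<lambda>i j. x j powr (\<alpha> + (\<eta> + \<theta>) / 2 - 1) * (- expdiff \<theta> (ln (x j))) ^ (N - 1 - i)) =
    K * ensemble_weight M N \<alpha> \<eta> \<theta> (\<lambda>i. x (i - 1))"
proof -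
  obtain \<epsilon> where \<epsilon>: "\<And>y. fdet M (\<lambda>i j. y j ^ (M - 1 - i)) = \<epsilon> * (\<Prod>j<M. \<Prod>i<j. y j - y i :: real)"
    using fdet_vandermonde_reversed by blast
  define \<kappa> where "\<kappa> = (\<lambda>s :: real. if s = 0 then 1 else 1 / s)"
  let ?\<beta> = "\<alpha> + (\<eta> + \<theta>) / 2 - 1"
  let ?V = "\<lambda>s x. \<Prod>j<M. \<Prod>i<j. power_difference s (x i) (x j)"
  define K where "K = (\<Prod>j<M. \<Prod>i<j. \<kappa> \<eta>) * ((\<Prod>j<M. \<kappa> \<theta> ^ (N - M)) * (\<epsilon> * (\<Prod>j<M. \<Prod>i<j. - \<kappa> \<theta>)))"
  have "fdet M (\<lambda>i j. expdiff \<eta> (ln (x j)) ^ i) *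
      fdet M (\<lambda>i j. x j powr ?\<beta> * (- expdiff \<theta> (ln (x j))) ^ (N - 1 - i)) =
      K * ensemble_weight M N \<alpha> \<eta> \<theta> (\<lambda>i. x (i - 1))"
    if x: "\<forall>j<M. 0 < x j" for x
  proof -
    let ?h = "\<lambda>j. - expdiff \<theta> (ln (x j))"
    have A: "fdet M (\<lambda>i j. expdiff \<eta> (ln (x j)) ^ i) = (\<Prod>j<M. \<Prod>i<j. \<kappa> \<eta>) * ?V \<eta> x"
      unfolding fdet_vandermonde prod_triangle_scale[symmetric] \<kappa>_def
      by (intro prod.cong refl expdiff_ln_diff) (use x in auto)
    have h: "?h j = \<kappa> \<theta> * power_difference \<theta> (x j) 1" if "j < M" for j
      using expdiff_ln_diff[of "x j" 1 \<theta>] x that by (simp add: \<kappa>_def)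
    have "fdet M (\<lambda>i j. x j powr ?\<beta> * ?h j ^ (N - 1 - i)) =
        fdet M (\<lambda>i j. x j powr ?\<beta> * ?h j ^ (N - M) * ?h j ^ (M - 1 - i))"
    proof (rule fdet_cong)
      fix i j assume "i < M"
      then have "N - 1 - i = (N - M) + (M - 1 - i)" using assms by simp
      then show "x j powr ?\<beta> * ?h j ^ (N - 1 - i) = x j powr ?\<beta> * ?h j ^ (N - M) * ?h j ^ (M - 1 - i)"
        by (simp only: power_add mult.assoc)
    qed
    also have "\<dots> = (\<Prod>j<M. x j powr ?\<beta> * ?h j ^ (N - M)) * (\<epsilon> * (\<Prod>j<M. \<Prod>i<j. ?h j - ?h i))"
      unfolding fdet_scale_columns \<epsilon> ..
    also have "(\<Prod>j<M. \<Prod>i<j. ?h j - ?h i) = (\<Prod>j<M. \<Prod>i<j. - \<kappa> \<theta>) * ?V \<theta> x"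
      unfolding prod_triangle_scale[symmetric]
    proof (intro prod.cong refl)
      fix i j assume "j \<in> {..<M}" "i \<in> {..<j}"
      then show "?h j - ?h i = - \<kappa> \<theta> * power_difference \<theta> (x i) (x j)"
        using expdiff_ln_diff[of "x i" "x j" \<theta>] x by (simp add: \<kappa>_def)
    qed
    also have "(\<Prod>j<M. x j powr ?\<beta> * ?h j ^ (N - M)) =
        (\<Prod>j<M. \<kappa> \<theta> ^ (N - M)) * (\<Prod>j<M. x j powr ?\<beta> * power_difference \<theta> (x j) 1 ^ (N - M))"
      unfolding prod.distrib[symmetric] by (intro prod.cong refl) (simp add: h power_mult_distrib)
    finally have B: "fdet M (\<lambda>i j. x j powr ?\<beta> * ?h j ^ (N - 1 - i)) =
        (\<Prod>j<M. \<kappa> \<theta> ^ (N - M)) * (\<Prod>j<M. x j powr ?\<beta> * power_difference \<theta> (x j) 1 ^ (N - M)) *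
        (\<epsilon> * ((\<Prod>j<M. \<Prod>i<j. - \<kappa> \<theta>) * ?V \<theta> x))" .
    have "ensemble_weight M N \<alpha> \<eta> \<theta> (\<lambda>i. x (i - 1)) = ?V \<eta> x * ?V \<theta> x *
        (\<Prod>j<M. x j powr ?\<beta> * power_difference \<theta> (x j) 1 ^ (N - M))"
    proof -
      have shift: "(\<Prod>j\<in>{1..n}. F j) = (\<Prod>j<n. F (Suc j))" for F :: "nat \<Rightarrow> real" and n
        by (induction n) simp_all
      have shift': "(\<Prod>j\<in>{1..<Suc n}. F j) = (\<Prod>j<n. F (Suc j))" for F :: "nat \<Rightarrow> real" and n
        using shift[of F n] by (simp add: atLeastLessThanSuc_atLeastAtMost)
      show ?thesis
        unfolding ensemble_weight_def shift shift' prod.distrib by simp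
    qed
    then show ?thesis unfolding A B K_def by (simp only: mult_ac)
  qed
  then show ?thesis by blast
qed

lemma borel_measurable_expdiff [measurable]: "expdiff s \<in> borel_measurable borel"
  unfolding expdiff_def[abs_def] by measurable

lemma measurable_strict_mono_on:
  fixes \<mu> :: "nat \<Rightarrow> real measure"
  assumes "\<And>i. i \<in> I \<Longrightarrow> sets (\<mu> i) = sets borel" "finite I"
  shows "Measurable.pred (PiM I \<mu>) (strict_mono_on I)"
proof -
  have comp: "(\<lambda>x. x i) \<in> borel_measurable (PiM I \<mu>)" if "i \<in> I" for i
    using measurable_component_singleton[OF that, of \<mu>] assms(1)[OF that]
      measurable_cong_sets[OF refl, of "\<mu> i" borel "PiM I \<mu>"] by simp
  have "{x \<in> space (PiM I \<mu>). \<forall>i\<in>I. \<forall>j\<in>I. i < j \<longrightarrow> x i < x j} \<in> sets (PiM I \<mu>)"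
    using assms(2)
    by (intro sets.sets_Collect_finite_All sets.sets_Collect_imp sets.sets_Collect_const
        borel_measurable_less comp) auto
  moreover have "strict_mono_on I x \<longleftrightarrow> (\<forall>i\<in>I. \<forall>j\<in>I. i < j \<longrightarrow> x i < x j)" for x :: "nat \<Rightarrow> real"
    by (auto simp: strict_mono_on_def)
  ultimately show ?thesis by (simp only: pred_def)
qed

lemma ensemble_weight_cong:
  assumes "\<And>i. i \<in> {1..M} \<Longrightarrow> x i = y i"
  shows "ensemble_weight M N \<alpha> \<eta> \<theta> x = ensemble_weight M N \<alpha> \<eta> \<theta> y"
  unfolding ensemble_weight_def
  by (intro arg_cong2[where f = "(*)"] prod.cong refl) (simp_all add: assms)

text \<open>\<open>andreief\<close> with one family of functions restricted to
  \<open>{s<..<1}\<close>. For ordered points the condition on \<open>x 1\<close> confines all of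
  them to this interval, and away from 0 the integrands are continuous, so integrability holds
  without any condition on the exponents.\<close>

lemma ensemble_weight_integral:
  assumes M: "1 \<le> M" "M \<le> N"
  shows "\<exists>K. \<forall>s. 0 < s \<longrightarrow> s < 1 \<longrightarrow>
    integrable (PiM {1..M} (\<lambda>_. lborel)) (\<lambda>x. indicator {x \<in> ordered_configurations M. s < x 1} x *
      (K * ensemble_weight M N \<alpha> \<eta> \<theta> x)) \<and>
    (\<integral>x. indicator {x \<in> ordered_configurations M. s < x 1} x *
      (K * ensemble_weight M N \<alpha> \<eta> \<theta> x) \<partial>PiM {1..M} (\<lambda>_. lborel)) =
    fdet M (\<lambda>m j. integral {s..1} (\<lambda>x. expdiff \<eta> (ln x) ^ m *
      (x powr (\<alpha> + (\<eta> + \<theta>) / 2 - 1) * (- expdiff \<theta> (ln x)) ^ (N - 1 - j))))"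
proof -
  let ?\<beta> = "\<alpha> + (\<eta> + \<theta>) / 2 - 1"
  obtain K where K: "\<And>x. \<forall>j<M. 0 < x j \<Longrightarrow> fdet M (\<lambda>i j. expdiff \<eta> (ln (x j)) ^ i) *
      fdet M (\<lambda>i j. x j powr ?\<beta> * (- expdiff \<theta> (ln (x j))) ^ (N - 1 - i)) =
      K * ensemble_weight M N \<alpha> \<eta> \<theta> (\<lambda>i. x (i - 1))"
    using ensemble_weight_eq_fdet[OF M(2), of \<eta> \<alpha> \<theta>] by blast
  have main: "integrable (PiM {1..M} (\<lambda>_. lborel)) (\<lambda>x. indicator {x \<in> ordered_configurations M. s < x 1} x *
      (K * ensemble_weight M N \<alpha> \<eta> \<theta> x)) \<and>
    (\<integral>x. indicator {x \<in> ordered_configurations M. s < x 1} x *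
      (K * ensemble_weight M N \<alpha> \<eta> \<theta> x) \<partial>PiM {1..M} (\<lambda>_. lborel)) =
    fdet M (\<lambda>m j. integral {s..1} (\<lambda>x. expdiff \<eta> (ln x) ^ m *
      (x powr ?\<beta> * (- expdiff \<theta> (ln x)) ^ (N - 1 - j))))"
    (is "integrable ?L' ?g \<and> _ = ?D") if s: "0 < s" "s < 1" for s
  proof -
    let ?L = "PiM {..<M} (\<lambda>_. lborel :: real measure)"
    define P where "P = (\<lambda>i y. expdiff \<eta> (ln y) ^ i)"
    define q where "q = (\<lambda>j y. y powr ?\<beta> * (- expdiff \<theta> (ln y)) ^ (N - 1 - j))"
    define Q where "Q = (\<lambda>j y. indicator {s<..<1} y * q j y)"
    have PQ: "P i \<in> borel_measurable lborel" "Q i \<in> borel_measurable lborel" for i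
      unfolding P_def Q_def q_def by measurable
    have int: "integrable lborel (\<lambda>y. P i y * Q j y)"
      "(\<integral>y. P i y * Q j y \<partial>lborel) = integral {s..1} (\<lambda>y. P i y * q j y)" for i j
    proof -
      have "continuous_on {s..1} (\<lambda>y. P i y * q j y)"
        unfolding P_def q_def using s by (auto intro!: continuous_intros)
      then have "set_integrable lborel {s..1} (\<lambda>y. P i y * q j y)"
        by (rule borel_integrable_atLeastAtMost')
      then have *: "set_integrable lborel {s<..<1} (\<lambda>y. P i y * q j y)"
        by (rule set_integrable_subset) auto
      then show "integrable lborel (\<lambda>y. P i y * Q j y)"
        by (simp add: set_integrable_def Q_def mult_ac)
      have "(\<integral>y. P i y * Q j y \<partial>lborel) = (LINT y:{s<..<1}|lborel. P i y * q j y)"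
        by (simp add: set_lebesgue_integral_def Q_def mult_ac)
      also have "\<dots> = integral {s<..<1} (\<lambda>y. P i y * q j y)"
        by (rule set_borel_integral_eq_integral(2)[OF *])
      also have "\<dots> = integral {s..1} (\<lambda>y. P i y * q j y)"
        by (rule integral_open_interval_real[symmetric])
      finally show "(\<integral>y. P i y * Q j y \<partial>lborel) = integral {s..1} (\<lambda>y. P i y * q j y)" .
    qed
    define C where "C = (\<lambda>x. indicator {x. strict_mono_on {..<M} x} x *
        (fdet M (\<lambda>i j. P i (x j)) * fdet M (\<lambda>i j. Q i (x j))))"
    have mono: "Measurable.pred ?L (strict_mono_on {..<M})"
      by (rule measurable_strict_mono_on) auto
    have C: "integrable ?L C" "(\<integral>x. C x \<partial>?L) = ?D"
      using andreief[where P = P and Q = Q, OF lborel.sigma_finite_measure_axioms PQ int(1) mono]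
      unfolding int(2) C_def by (simp_all add: P_def q_def)
    define T where "T = (\<lambda>x :: nat \<Rightarrow> real. \<lambda>i\<in>{..<M}. x (Suc i))"
    have T: "T \<in> measurable ?L' ?L"
      unfolding T_def by (intro measurable_restrict measurable_component_singleton) auto
    have D: "distr ?L' ?L T = ?L"
      unfolding T_def
      by (rule distr_PiM_reindex_sigma_finite)
         (auto simp: lborel.sigma_finite_measure_axioms bij_betw_def image_Suc_lessThan)
    \<comment> \<open>A point outside \<open>{s<..<1}\<close> makes a column of the second
      determinant zero; on the other side it excludes \<open>x\<close> from the configurations with
      \<open>s < x 1\<close>.\<close>
    have CT: "C (T x) = ?g x" if "x \<in> space ?L'" for x
    proof (cases "\<forall>j<M. s < x (Suc j) \<and> x (Suc j) < 1")
      case True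
      have pos: "\<forall>j<M. 0 < T x j" using True s by (auto simp: T_def)
      have "fdet M (\<lambda>i j. Q i (T x j)) = (\<Prod>j<M. indicator {s<..<1} (T x j)) * fdet M (\<lambda>i j. q i (T x j))"
        unfolding Q_def by (rule fdet_scale_columns)
      also have "(\<Prod>j<M. indicator {s<..<1} (T x j)) = (1 :: real)"
        by (intro prod.neutral) (use True in \<open>auto simp: T_def\<close>)
      finally have "fdet M (\<lambda>i j. P i (T x j)) * fdet M (\<lambda>i j. Q i (T x j)) =
          K * ensemble_weight M N \<alpha> \<eta> \<theta> (\<lambda>i. T x (i - 1))"
        using K[OF pos] by (simp add: P_def q_def)
      also have "ensemble_weight M N \<alpha> \<eta> \<theta> (\<lambda>i. T x (i - 1)) = ensemble_weight M N \<alpha> \<eta> \<theta> x"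
        by (rule ensemble_weight_cong) (auto simp: T_def)
      finally have w: "fdet M (\<lambda>i j. P i (T x j)) * fdet M (\<lambda>i j. Q i (T x j)) =
          K * ensemble_weight M N \<alpha> \<eta> \<theta> x" .
      have all: "s < x i \<and> x i < 1" if "i \<in> {1..M}" for i
        using True[rule_format, of "i - 1"] that by auto
      have "strict_mono_on {..<M} (T x) \<longleftrightarrow> strict_mono_on {1..M} x"
      proof
        assume L: "strict_mono_on {..<M} (T x)"
        show "strict_mono_on {1..M} x"
        proof (rule strict_mono_onI)
          fix i j assume "i \<in> {1..M}" "j \<in> {1..M}" "i < j"
          then show "x i < x j" using strict_mono_onD[OF L, of "i - 1" "j - 1"] by (auto simp: T_def)
        qed
      next
        assume R: "strict_mono_on {1..M} x"
        show "strict_mono_on {..<M} (T x)"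
          by (rule strict_mono_onI) (auto simp: T_def intro!: strict_mono_onD[OF R])
      qed
      then have "T x \<in> {x. strict_mono_on {..<M} x} \<longleftrightarrow> x \<in> {x \<in> ordered_configurations M. s < x 1}"
        using that all M s by (force simp: ordered_configurations_def space_PiM PiE_iff)
      then show ?thesis unfolding C_def w by (simp only: indicator_def)
    next
      case False
      then obtain j where j: "j < M" "\<not> (s < x (Suc j) \<and> x (Suc j) < 1)" by blast
      have "fdet M (\<lambda>i j. Q i (T x j)) = 0"
        by (rule fdet_zero_column[OF j(1)]) (use j in \<open>auto simp: Q_def T_def\<close>)
      moreover have "x \<notin> {x \<in> ordered_configurations M. s < x 1}"
      proof
        assume x: "x \<in> {x \<in> ordered_configurations M. s < x 1}"
        then have R: "strict_mono_on {1..M} x" "x (Suc j) \<in> {0<..<1}"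
          using j by (auto simp: ordered_configurations_def PiE_iff)
        have "x 1 \<le> x (Suc j)"
        proof (cases j)
          case (Suc l)
          then show ?thesis using strict_mono_onD[OF R(1), of 1 "Suc j"] j M by simp
        qed simp
        then show False using x R j by auto
      qed
      ultimately show ?thesis unfolding C_def by simp
    qed
    have "integrable ?L' (\<lambda>x. C (T x))"
      using integrable_distr[OF T, of C] C(1) unfolding D by simp
    then have "integrable ?L' ?g"
      by (rule Bochner_Integration.integrable_cong[OF refl, THEN iffD1, rotated]) (rule CT)
    moreover have "integral\<^sup>L ?L' ?g = (\<integral>x. C (T x) \<partial>?L')"
      by (rule Bochner_Integration.integral_cong[OF refl]) (rule CT[symmetric])
    moreover have "(\<integral>x. C (T x) \<partial>?L') = (\<integral>x. C x \<partial>?L)"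
      using integral_distr[OF T, of C] borel_measurable_integrable[OF C(1)] unfolding D by simp
    ultimately show ?thesis using C(2) by simp
  qed
  then show ?thesis by blast
qed

text \<open>With all thresholds equal to \<open>- ln s\<close>, monotonicity in the row leaves only
  the condition on the last row. What matters about \<open>K\<close> is that it precedes s in the
  quantifiers.\<close>

lemma (in arithmetic_rates) lpp_tail:
  assumes M: "1 \<le> M" "M \<le> N"
    and rate_pos: "\<And>k n. k < M \<Longrightarrow> 1 \<le> n \<Longrightarrow> n \<le> N \<Longrightarrow> 0 < rate k n"
    and \<alpha>: "rate 0 1 = \<alpha> + (\<eta> + \<theta>) / 2"
  shows "\<exists>K. \<forall>s. 0 < s \<longrightarrow> s < 1 \<longrightarrow>
    integrable (PiM {1..M} (\<lambda>_. lborel)) (\<lambda>x. indicator {x \<in> ordered_configurations M. s < x 1} x *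
      (K * ensemble_weight M N \<alpha> \<eta> \<theta> x)) \<and>
    measure (PiM ({1..M} \<times> {1..N}) cell_law)
      {w \<in> space (PiM ({1..M} \<times> {1..N}) cell_law). lpp w (M - 1) N < - ln s} =
    (\<integral>x. indicator {x \<in> ordered_configurations M. s < x 1} x *
      (K * ensemble_weight M N \<alpha> \<eta> \<theta> x) \<partial>PiM {1..M} (\<lambda>_. lborel))"
proof -
  let ?I = "{1..M} \<times> {1..N}"
  obtain K where K: "\<And>s. 0 < s \<Longrightarrow> s < 1 \<Longrightarrow>
      integrable (PiM {1..M} (\<lambda>_. lborel)) (\<lambda>x. indicator {x \<in> ordered_configurations M. s < x 1} x *
        (K * ensemble_weight M N \<alpha> \<eta> \<theta> x)) \<and>
      (\<integral>x. indicator {x \<in> ordered_configurations M. s < x 1} x *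
        (K * ensemble_weight M N \<alpha> \<eta> \<theta> x) \<partial>PiM {1..M} (\<lambda>_. lborel)) =
      fdet M (\<lambda>m j. integral {s..1} (\<lambda>x. expdiff \<eta> (ln x) ^ m *
        (x powr (\<alpha> + (\<eta> + \<theta>) / 2 - 1) * (- expdiff \<theta> (ln x)) ^ (N - 1 - j))))"
    using ensemble_weight_integral[OF M, of \<alpha> \<eta> \<theta>] by blast
  define c where "c = (\<Prod>c\<in>?I. cell_rate c) * (\<Prod>j<M. 1 / (fact j * fact (N - 1 - j)))"
  have prob: "measure (PiM ?I cell_law) {w \<in> space (PiM ?I cell_law). lpp w (M - 1) N < - ln s} =
      c * fdet M (\<lambda>m j. integral {s..1} (\<lambda>x. expdiff \<eta> (ln x) ^ m *
        (x powr (\<alpha> + (\<eta> + \<theta>) / 2 - 1) * (- expdiff \<theta> (ln x)) ^ (N - 1 - j))))"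
    if s: "0 < s" "s < 1" for s
  proof -
    let ?t = "- ln s"
    have t: "0 < ?t" using s by simp
    have cells: "cells M (N - 1) M = ?I" using M by (auto simp: cells_def)
    have "(\<forall>j<M. lpp w j (level (N - 1) M j) < ?t) \<longleftrightarrow> lpp w (M - 1) N < ?t" for w
    proof -
      have lev: "level (N - 1) M j = N" if "j < M" for j using that M by (simp add: level_def)
      have "lpp w j N \<le> lpp w (M - 1) N" if "j < M" for j using that by (intro lpp_mono_row) simp
      then show ?thesis using lev M by (auto intro: le_less_trans)
    qed
    then have "measure (PiM ?I cell_law) {w \<in> space (PiM ?I cell_law). lpp w (M - 1) N < ?t} =
        (\<Prod>c\<in>?I. cell_rate c) * chi_det M (N - 1) M (\<lambda>_. ?t)"
      using lpp_joint_distribution[OF rate_pos, of M N "N - 1" M "\<lambda>_. ?t"] t M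
      unfolding cells by (simp add: mono_on_def)
    also have "chi_det M (N - 1) M (\<lambda>_. ?t) = fdet M (\<lambda>i j. chi N i j ?t)"
      unfolding chi_det_def by (rule fdet_cong) (use M in \<open>simp add: level_def\<close>)
    also have "\<dots> = (\<Prod>j<M. 1 / (fact j * fact (N - 1 - j))) * fdet M (\<lambda>m j. chi_moment m (N - 1 - j) ?t)"
      by (rule fdet_chi) (use t M in auto)
    finally show ?thesis unfolding chi_moment_substitution[OF s] \<alpha> c_def by (simp only: mult.assoc)
  qed
  show ?thesis
  proof (intro exI[of _ "c * K"] allI impI conjI)
    fix s :: real assume s: "0 < s" "s < 1"
    have eq: "(\<lambda>x. indicator {x \<in> ordered_configurations M. s < x 1} x * (c * K * ensemble_weight M N \<alpha> \<eta> \<theta> x)) =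
        (\<lambda>x. c * (indicator {x \<in> ordered_configurations M. s < x 1} x * (K * ensemble_weight M N \<alpha> \<eta> \<theta> x)))"
      by (rule ext) (simp only: mult_ac)
    show "integrable (PiM {1..M} (\<lambda>_. lborel)) (\<lambda>x. indicator {x \<in> ordered_configurations M. s < x 1} x *
        (c * K * ensemble_weight M N \<alpha> \<eta> \<theta> x))"
      unfolding eq using K[OF s] by (intro Bochner_Integration.integrable_mult_right) simp
    show "measure (PiM ?I cell_law) {w \<in> space (PiM ?I cell_law). lpp w (M - 1) N < - ln s} =
        (\<integral>x. indicator {x \<in> ordered_configurations M. s < x 1} x *
          (c * K * ensemble_weight M N \<alpha> \<eta> \<theta> x) \<partial>PiM {1..M} (\<lambda>_. lborel))"
      unfolding eq prob[OF s] using K[OF s] by (simp only: Bochner_Integration.integral_mult_right_zero)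
  qed
qed

section \<open>Lattice paths and comparison of laws\<close>

lemma sum_path_le_lpp:
  assumes "p \<noteq> []" "successively step_up p" "hd p = (1, 1)" "last p = (Suc k, n)"
  shows "(\<Sum>c\<in>set p. max 0 (w c)) \<le> lpp w k n"
  using assms
proof (induction p arbitrary: k n rule: rev_induct)
  case (snoc c q)
  have c: "c = (Suc k, n)" using snoc.prems by simp
  show ?case
  proof (cases "q = []")
    case True
    then have "k = 0" "n = 1" using snoc.prems by simp_all
    then show ?thesis using True c by simp
  next
    case False
    then have q: "successively step_up q" "hd q = (1, 1)" "step_up (last q) c"
      using snoc.prems by (auto simp: successively_append_iff)
    obtain a b where ab: "last q = (a, b)" by force
    have "last q \<in> {1..a} \<times> {1..b}"
      using step_up_path_bounds[OF False q(1)] q(2) ab last_in_set[OF False] by auto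
    then have "1 \<le> a" "1 \<le> b" using ab by auto
    then obtain a' where a': "a = Suc a'" by (cases a) auto
    have IH: "(\<Sum>c\<in>set q. max 0 (w c)) \<le> lpp w a' b"
      using snoc.IH[OF False q(1,2)] ab a' by simp
    have "lpp w a' b + max 0 (w (Suc k, n)) \<le> lpp w k n"
      using q(3) \<open>1 \<le> b\<close> unfolding ab a' c by (cases k; cases n) auto
    \<comment> \<open>The summands are nonnegative, so the inequality holds whether or not
      \<open>c\<close> already occurs in \<open>q\<close>.\<close>
    moreover have "(\<Sum>c\<in>set (q @ [c]). max 0 (w c)) \<le> (\<Sum>c\<in>set q. max 0 (w c)) + max 0 (w c)"
      by (simp add: sum.insert_if)
    ultimately show ?thesis using IH c by simp
  qed
qed simp

lemma lpp_attained:
  assumes "1 \<le> n"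
  shows "\<exists>p\<in>lattice_paths step_up (1, 1) (Suc k, n). (\<Sum>c\<in>set p. max 0 (w c)) = lpp w k n"
proof -
  have snoc: "\<exists>p\<in>lattice_paths step_up (1, 1) (Suc k, n). (\<Sum>c\<in>set p. max 0 (w c)) = S + max 0 (w (Suc k, n))"
    if p: "\<exists>p\<in>lattice_paths step_up (1, 1) d. (\<Sum>c\<in>set p. max 0 (w c)) = S" and d: "step_up d (Suc k, n)"
    for d S k n and w :: "cell \<Rightarrow> real"
  proof -
    obtain p where p: "p \<in> lattice_paths step_up (1, 1) d" "(\<Sum>c\<in>set p. max 0 (w c)) = S"
      using p by blast
    have "set p \<subseteq> {1..fst d} \<times> {1..snd d}"
      using step_up_path_bounds[of p] p(1) by (auto simp: lattice_paths_def)
    \<comment> \<open>Equality is wanted here, so the appended cell must be new: it lies outside the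
      box that contains \<open>p\<close>.\<close>
    then have "(Suc k, n) \<notin> set p" using d by (cases d) auto
    then have "(\<Sum>c\<in>set (p @ [(Suc k, n)]). max 0 (w c)) = S + max 0 (w (Suc k, n))"
      using p(2) by simp
    moreover have "p @ [(Suc k, n)] \<in> lattice_paths step_up (1, 1) (Suc k, n)"
      using p(1) d by (auto simp: lattice_paths_def successively_append_iff)
    ultimately show ?thesis by blast
  qed
  show ?thesis using assms
  proof (induction w k n rule: lpp.induct)
    case (2 w n)
    show ?case
    proof (cases "n = 0")
      case True
      have "[(1, 1)] \<in> lattice_paths step_up (1, 1) (1, 1)" by (simp add: lattice_paths_def)
      then show ?thesis using True by (intro bexI[of _ "[(1, 1)]"]) auto
    next
      case False
      then show ?thesis using snoc[of "(Suc 0, n)" w "lpp w 0 n" 0 "Suc n"] 2 by simp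
    qed
  next
    case (3 w k n)
    show ?case
    proof (cases "lpp w (Suc k) n \<le> lpp w k (Suc n)")
      case True
      then show ?thesis
        using snoc[of "(Suc k, Suc n)" w "lpp w k (Suc n)" "Suc k" "Suc n"] 3 by simp
    next
      case False
      \<comment> \<open>At n = 0 the strictly larger value would be 0, against nonnegativity; so the
        induction hypothesis for column n applies.\<close>
      then have "1 \<le> n" using lpp_nonneg[of w k "Suc n"] by (cases n) auto
      then show ?thesis
        using snoc[of "(Suc (Suc k), n)" w "lpp w (Suc k) n" "Suc k" "Suc n"] 3 False by simp
    qed
  qed simp
qed

text \<open>For weights in (0, 1] the truncation in \<open>lpp\<close> is inert, and the decreasing
  map from u to \<open>exp (- u)\<close> turns sums into products and the maximum over paths into
  the minimum.\<close>

lemma L1_eq_exp_lpp: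
  assumes M: "1 \<le> M" "1 \<le> N"
    and w: "\<And>c. c \<in> {1..M} \<times> {1..N} \<Longrightarrow> 0 < w c \<and> w c \<le> 1"
  shows "L1 M N w = exp (- lpp (\<lambda>c. - ln (w c)) (M - 1) N)"
proof -
  let ?E = "\<lambda>c. - ln (w c)"
  have prod_eq: "(\<Prod>c\<in>set p. w c) = exp (- (\<Sum>c\<in>set p. max 0 (?E c)))"
    if "p \<in> lattice_paths step_up (1, 1) (M, N)" for p
  proof -
    have "set p \<subseteq> {1..M} \<times> {1..N}"
      using that step_up_path_bounds[of p] by (auto simp: lattice_paths_def)
    then have "w c = exp (- max 0 (?E c))" if "c \<in> set p" for c
      using w[of c] that by auto
    then have "(\<Prod>c\<in>set p. w c) = (\<Prod>c\<in>set p. exp (- max 0 (?E c)))" by (intro prod.cong) auto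
    also have "\<dots> = exp (\<Sum>c\<in>set p. - max 0 (?E c))" by (rule exp_sum[symmetric]) simp
    finally show ?thesis by (simp only: sum_negf)
  qed
  show ?thesis
    unfolding L1_def
  proof (rule Min_eqI)
    show "finite ((\<lambda>p. \<Prod>c\<in>set p. w c) ` lattice_paths step_up (1, 1) (M, N))"
      by (intro finite_imageI finite_lattice_paths)
  next
    fix y assume "y \<in> (\<lambda>p. \<Prod>c\<in>set p. w c) ` lattice_paths step_up (1, 1) (M, N)"
    then obtain p where p: "p \<in> lattice_paths step_up (1, 1) (M, N)" "y = (\<Prod>c\<in>set p. w c)" by blast
    have "(\<Sum>c\<in>set p. max 0 (?E c)) \<le> lpp ?E (M - 1) N"
      using p(1) M by (intro sum_path_le_lpp) (auto simp: lattice_paths_def)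
    then show "exp (- lpp ?E (M - 1) N) \<le> y" using p prod_eq[OF p(1)] by simp
  next
    obtain p where "p \<in> lattice_paths step_up (1, 1) (M, N)" "(\<Sum>c\<in>set p. max 0 (?E c)) = lpp ?E (M - 1) N"
      using lpp_attained[OF M(2), of "M - 1" ?E] M(1) by auto
    then show "exp (- lpp ?E (M - 1) N) \<in> (\<lambda>p. \<Prod>c\<in>set p. w c) ` lattice_paths step_up (1, 1) (M, N)"
      using prod_eq[of p] by (intro image_eqI[of _ _ p]) simp_all
  qed
qed

lemma L2_eq_L1_reflected: "L2 M N w = L1 M N (\<lambda>c. w (M + 1 - fst c, snd c))"
proof -
  \<comment> \<open>The subtraction is truncated, so \<phi> is an involution only on rows 1 to M;
    hence the repeated appeal to the bounds on paths.\<close>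
  define \<phi> where "\<phi> = (\<lambda>c :: cell. (M + 1 - fst c, snd c))"
  have up: "map \<phi> p \<in> lattice_paths step_down (M, 1) (1, N)" "(\<Prod>c\<in>set p. w (\<phi> c)) = (\<Prod>c\<in>set (map \<phi> p). w c)"
    if p: "p \<in> lattice_paths step_up (1, 1) (M, N)" for p
  proof -
    have s: "set p \<subseteq> {1..M} \<times> {1..N}"
      using p step_up_path_bounds[of p] by (auto simp: lattice_paths_def)
    have "successively (\<lambda>x y. step_down (\<phi> x) (\<phi> y)) p"
      by (rule successively_mono[where P = step_up]) (use p s in \<open>auto simp: lattice_paths_def \<phi>_def\<close>)
    then show "map \<phi> p \<in> lattice_paths step_down (M, 1) (1, N)"
      using p by (auto simp: lattice_paths_def successively_map hd_map last_map \<phi>_def)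
    have "inj_on \<phi> (set p)"
      by (rule inj_on_inverseI[where g = \<phi>]) (use s in \<open>auto simp: \<phi>_def\<close>)
    then show "(\<Prod>c\<in>set p. w (\<phi> c)) = (\<Prod>c\<in>set (map \<phi> p). w c)"
      by (simp add: prod.reindex)
  qed
  have down: "map \<phi> p \<in> lattice_paths step_up (1, 1) (M, N)" "map \<phi> (map \<phi> p) = p"
    if p: "p \<in> lattice_paths step_down (M, 1) (1, N)" for p
  proof -
    have s: "set p \<subseteq> {1..M} \<times> {1..N}"
      using p step_down_path_bounds[of p] by (auto simp: lattice_paths_def)
    have "successively (\<lambda>x y. step_up (\<phi> x) (\<phi> y)) p"
      by (rule successively_mono[where P = step_down]) (use p s in \<open>auto simp: lattice_paths_def \<phi>_def\<close>)
    then show "map \<phi> p \<in> lattice_paths step_up (1, 1) (M, N)"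
      using p by (auto simp: lattice_paths_def successively_map hd_map last_map \<phi>_def)
    show "map \<phi> (map \<phi> p) = p"
      unfolding map_map by (rule map_idI) (use s in \<open>auto simp: \<phi>_def\<close>)
  qed
  have "(\<lambda>p. \<Prod>c\<in>set p. w c) ` lattice_paths step_down (M, 1) (1, N) =
      (\<lambda>p. \<Prod>c\<in>set p. w (\<phi> c)) ` lattice_paths step_up (1, 1) (M, N)"
  proof (intro equalityI image_subsetI)
    fix p assume p: "p \<in> lattice_paths step_down (M, 1) (1, N)"
    show "(\<Prod>c\<in>set p. w c) \<in> (\<lambda>p. \<Prod>c\<in>set p. w (\<phi> c)) ` lattice_paths step_up (1, 1) (M, N)"
    proof (rule image_eqI)
      show "(\<Prod>c\<in>set p. w c) = (\<Prod>c\<in>set (map \<phi> p). w (\<phi> c))"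
        using up(2)[OF down(1)[OF p]] unfolding down(2)[OF p] by (rule sym)
    qed (rule down(1)[OF p])
  next
    fix p assume p: "p \<in> lattice_paths step_up (1, 1) (M, N)"
    show "(\<Prod>c\<in>set p. w (\<phi> c)) \<in> (\<lambda>p. \<Prod>c\<in>set p. w c) ` lattice_paths step_down (M, 1) (1, N)"
      unfolding up(2)[OF p] using up(1)[OF p] by (rule imageI)
  qed
  then show ?thesis unfolding L1_def L2_def \<phi>_def by simp
qed

section \<open>Transfer from power laws to exponential weights\<close>

lemma (in prob_space) indep_vars_reindex:
  assumes ind: "indep_vars M' X I" and f: "inj_on f J" "f ` J \<subseteq> I"
  shows "indep_vars (\<lambda>j. M' (f j)) (\<lambda>j. X (f j)) J"
proof -
  have sets: "indep_sets (\<lambda>j. F (f j)) J" if F: "indep_sets F I" for F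
    unfolding indep_sets_def
  proof (intro conjI ballI allI impI)
    fix j assume "j \<in> J"
    then show "F (f j) \<subseteq> events" using F f by (auto simp: indep_sets_def)
  next
    fix K A assume K: "K \<subseteq> J" "K \<noteq> {}" "finite K" and A: "A \<in> Pi K (\<lambda>j. F (f j))"
    have inj: "inj_on f K" using f(1) K(1) by (rule inj_on_subset)
    define B where "B = (\<lambda>i. A (the_inv_into K f i))"
    have B: "B (f j) = A j" if "j \<in> K" for j using that inj by (simp add: B_def the_inv_into_f_f)
    have "B \<in> Pi (f ` K) F" using A B by auto
    moreover have "f ` K \<subseteq> I" "f ` K \<noteq> {}" "finite (f ` K)" using K f by auto
    ultimately have "prob (\<Inter>i\<in>f ` K. B i) = (\<Prod>i\<in>f ` K. prob (B i))"
      using F unfolding indep_sets_def by blast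
    then show "prob (\<Inter>j\<in>K. A j) = (\<Prod>j\<in>K. prob (A j))"
      using B by (simp add: prod.reindex[OF inj])
  qed
  show ?thesis
    using ind f sets[of "\<lambda>i. { X i -` A \<inter> space M | A. A \<in> sets (M' i)}"]
    unfolding indep_vars_def2 by auto
qed

lemma (in prob_space) distributed_pow_density:
  assumes d: "distributed M lborel X (pow_density b)" and b: "0 < b"
  shows "AE s in M. 0 < X s \<and> X s \<le> 1"
    and "distributed M lborel (\<lambda>s. - ln (X s)) (exponential_density b)"
proof -
  have X [measurable]: "X \<in> borel_measurable M" using distributed_measurable[OF d] by simp
  show AE: "AE s in M. 0 < X s \<and> X s \<le> 1"
    by (subst distributed_AE2[OF d])
       (auto intro!: AE_I2 simp: pow_density_def indicator_def order_le_less split: if_splits)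
  show "distributed M lborel (\<lambda>s. - ln (X s)) (exponential_density b)"
    unfolding exponential_distributed_iff[OF b]
  proof (intro conjI allI impI)
    show "(\<lambda>s. - ln (X s)) \<in> borel_measurable M" by measurable
    fix a :: real assume a: "0 \<le> a"
    let ?e = "exp (- a)"
    have "((\<lambda>x. b * x powr (b - 1)) has_integral 1 powr b - ?e powr b) {?e..1}"
    proof (rule fundamental_theorem_of_calculus)
      fix x assume "x \<in> {?e..1}"
      then have "0 < x" using exp_gt_zero[of "- a"] by (meson atLeastAtMost_iff less_le_trans)
      then show "((\<lambda>x. x powr b) has_vector_derivative b * x powr (b - 1)) (at x within {?e..1})"
        unfolding has_real_derivative_iff_has_vector_derivative[symmetric]
        by (auto intro!: derivative_eq_intros)
    qed (use a in simp)
    then have "(\<integral>\<^sup>+x. ennreal (indicator {?e..1} x * (b * x powr (b - 1))) \<partial>lborel) = ennreal (1 powr b - ?e powr b)"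
      by (rule nn_integral_has_integral_lebesgue[rotated]) (use b in simp)
    also have "?e powr b = exp (- a * b)" by (simp add: powr_def mult.commute)
    also have "(\<integral>\<^sup>+x. ennreal (indicator {?e..1} x * (b * x powr (b - 1))) \<partial>lborel) =
        (\<integral>\<^sup>+x. pow_density b x * indicator {?e..} x \<partial>lborel)"
    proof (rule nn_integral_cong)
      fix x :: real
      show "ennreal (indicator {?e..1} x * (b * x powr (b - 1))) = pow_density b x * indicator {?e..} x"
        using less_le_trans[OF exp_gt_zero[of "- a"], of x] by (auto simp: pow_density_def indicator_def)
    qed
    also have "\<dots> = emeasure M (X -` {?e..} \<inter> space M)"
      by (rule distributed_emeasure[OF d, symmetric]) simp
    finally have "emeasure M (X -` {?e..} \<inter> space M) = ennreal (1 - exp (- a * b))" by simp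
    then have "prob (X -` {?e..} \<inter> space M) = 1 - exp (- a * b)"
      using a b by (simp add: measure_def)
    also have "prob (X -` {?e..} \<inter> space M) = \<P>(s in M. - ln (X s) \<le> a)"
    proof (rule finite_measure_eq_AE)
      show "AE s in M. s \<in> X -` {?e..} \<inter> space M \<longleftrightarrow> s \<in> {s \<in> space M. - ln (X s) \<le> a}"
        using AE AE_space
      proof eventually_elim
        case (elim s)
        then have "?e \<le> X s \<longleftrightarrow> - a \<le> ln (X s)" by (subst ln_ge_iff) auto
        then show ?case using elim by auto
      qed
    qed measurable
    finally show "\<P>(s in M. - ln (X s) \<le> a) = 1 - exp (- a * b)" .
  qed
qed

lemma measurable_L1 [measurable (raw)]:
  assumes "\<And>c. c \<in> {1..M} \<times> {1..N} \<Longrightarrow> \<omega> c \<in> borel_measurable P"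
  shows "(\<lambda>s. L1 M N (\<lambda>c. \<omega> c s)) \<in> borel_measurable P"
proof -
  have "(\<lambda>s. \<Prod>c\<in>set p. \<omega> c s) \<in> borel_measurable P" if "p \<in> lattice_paths step_up (1, 1) (M, N)" for p
  proof (rule borel_measurable_prod)
    fix c assume "c \<in> set p"
    moreover have "set p \<subseteq> {1..M} \<times> {1..N}"
      using that step_up_path_bounds[of p] by (auto simp: lattice_paths_def)
    ultimately show "\<omega> c \<in> borel_measurable P" using assms by blast
  qed
  then show ?thesis
    unfolding L1_def by (intro borel_measurable_Min finite_lattice_paths)
qed

text \<open>The parameters may have any sign as long as the rates in the rectangle are positive: the
  same statement serves the reversed rows, where \<eta> is replaced by its negative.\<close>

lemma L1_tail:
  fixes \<alpha> \<eta> \<theta> :: real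
  assumes M: "1 \<le> M" "M \<le> N" and P: "prob_space P"
    and ind: "prob_space.indep_vars P (\<lambda>_. borel) \<omega> ({1..M} \<times> {1..N})"
    and pos: "\<And>i j. i \<in> {1..M} \<Longrightarrow> j \<in> {1..N} \<Longrightarrow> 0 < \<alpha> + \<eta> * (real i - 1 / 2) + \<theta> * (real j - 1 / 2)"
    and d: "\<And>i j. i \<in> {1..M} \<Longrightarrow> j \<in> {1..N} \<Longrightarrow>
      distributed P lborel (\<omega> (i, j)) (pow_density (\<alpha> + \<eta> * (real i - 1 / 2) + \<theta> * (real j - 1 / 2)))"
  shows "(\<lambda>s. L1 M N (\<lambda>c. \<omega> c s)) \<in> borel_measurable P"
    and "AE s in P. 0 < L1 M N (\<lambda>c. \<omega> c s) \<and> L1 M N (\<lambda>c. \<omega> c s) \<le> 1"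
    and "\<exists>K. \<forall>a. 0 < a \<longrightarrow> a < 1 \<longrightarrow>
      integrable (PiM {1..M} (\<lambda>_. lborel)) (\<lambda>x. indicator {x \<in> ordered_configurations M. a < x 1} x *
        (K * ensemble_weight M N \<alpha> \<eta> \<theta> x)) \<and>
      measure P {s \<in> space P. a < L1 M N (\<lambda>c. \<omega> c s)} =
      (\<integral>x. indicator {x \<in> ordered_configurations M. a < x 1} x *
        (K * ensemble_weight M N \<alpha> \<eta> \<theta> x) \<partial>PiM {1..M} (\<lambda>_. lborel))"
proof -
  interpret prob_space P by fact
  \<comment> \<open>\<open>rate k n\<close> belongs to cell (k + 1, n), whose rate is
    \<open>\<alpha> + \<eta> * (k + 1 / 2) + \<theta> * (n - 1 / 2)\<close>; the third parameter is
    its constant term.\<close>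
  interpret arithmetic_rates \<eta> \<theta> "\<alpha> + \<eta> / 2 - \<theta> / 2" .
  let ?I = "{1..M} \<times> {1..N}" and ?L = "\<lambda>s. L1 M N (\<lambda>c. \<omega> c s)"
  define E where "E = (\<lambda>c s. - ln (\<omega> c s))"
  have rate: "rate (fst c - 1) (snd c) = \<alpha> + \<eta> * (real (fst c) - 1 / 2) + \<theta> * (real (snd c) - 1 / 2)"
    if "c \<in> ?I" for c
  proof -
    have "real (fst c - 1) = real (fst c) - 1" using that by (auto simp: of_nat_diff)
    then show ?thesis unfolding rate_def by (simp add: algebra_simps)
  qed
  have cr: "cell_rate c = \<alpha> + \<eta> * (real (fst c) - 1 / 2) + \<theta> * (real (snd c) - 1 / 2)" if "c \<in> ?I" for c
    using rate[OF that] pos[of "fst c" "snd c"] that by (auto simp: cell_rate_def)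
  have dc: "distributed P lborel (\<omega> c) (pow_density (cell_rate c))" if "c \<in> ?I" for c
    using d[of "fst c" "snd c"] that unfolding cr[OF that] by auto
  have \<omega>: "\<omega> c \<in> borel_measurable P" if "c \<in> ?I" for c
    using distributed_measurable[OF dc[OF that]] by simp
  show Lm: "?L \<in> borel_measurable P" by (rule measurable_L1) (rule \<omega>)
  have "AE s in P. \<forall>c\<in>?I. 0 < \<omega> c s \<and> \<omega> c s \<le> 1"
    by (rule AE_finite_allI) (use distributed_pow_density(1)[OF dc cell_rate_pos] in auto)
  then have L_eq: "AE s in P. ?L s = exp (- lpp (\<lambda>c. E c s) (M - 1) N)"
  proof eventually_elim
    case (elim s)
    then show ?case unfolding E_def using M by (intro L1_eq_exp_lpp) auto
  qed
  then show "AE s in P. 0 < ?L s \<and> ?L s \<le> 1"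
    by eventually_elim (simp add: lpp_nonneg)
  have Em: "E c \<in> borel_measurable P" if "c \<in> ?I" for c
    unfolding E_def using \<omega>[OF that] by measurable
  have E_law: "distr P borel (E c) = cell_law c" if "c \<in> ?I" for c
  proof -
    have "distributed P lborel (E c) (exponential_density (cell_rate c))"
      unfolding E_def by (rule distributed_pow_density(2)[OF dc[OF that] cell_rate_pos])
    then have "distr P lborel (E c) = cell_law c"
      unfolding cell_law_def by (rule distributed_distr_eq_density)
    moreover have "distr P borel (E c) = distr P lborel (E c)" by (rule distr_cong) simp_all
    ultimately show ?thesis by simp
  qed
  have "indep_vars (\<lambda>_. borel) E ?I"
    unfolding E_def by (rule indep_vars_compose2[OF ind]) simp
  then have joint: "distr P (PiM ?I (\<lambda>_. borel)) (\<lambda>s. \<lambda>c\<in>?I. E c s) = PiM ?I cell_law"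
    using M Em by (subst (asm) indep_vars_iff_distr_eq_PiM') (auto simp: E_law cong: PiM_cong)
  have lpp_m: "(\<lambda>w. lpp w (M - 1) N) \<in> borel_measurable (PiM ?I cell_law)"
    by (rule measurable_lpp) (use M in auto)
  have tail: "measure P {s \<in> space P. a < ?L s} =
      measure (PiM ?I cell_law) {w \<in> space (PiM ?I cell_law). lpp w (M - 1) N < - ln a}"
    if a: "0 < a" for a
  proof -
    let ?X = "\<lambda>s. \<lambda>c\<in>?I. E c s"
    have X: "?X \<in> measurable P (PiM ?I (\<lambda>_. borel))" by (intro measurable_restrict Em)
    have S: "{w \<in> space (PiM ?I cell_law). lpp w (M - 1) N < - ln a} \<in> sets (PiM ?I (\<lambda>_. borel))"
    proof -
      have "sets (PiM ?I cell_law) = sets (PiM ?I (\<lambda>_. borel))" by (intro sets_PiM_cong) auto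
      then show ?thesis using borel_measurable_less[OF lpp_m borel_measurable_const] by simp
    qed
    have "measure (PiM ?I cell_law) {w \<in> space (PiM ?I cell_law). lpp w (M - 1) N < - ln a} =
        measure P (?X -` {w \<in> space (PiM ?I cell_law). lpp w (M - 1) N < - ln a} \<inter> space P)"
      unfolding joint[symmetric] by (subst measure_distr[OF X]) (use S joint in simp_all)
    also have "\<dots> = measure P {s \<in> space P. a < ?L s}"
    proof (rule finite_measure_eq_AE)
      show "AE s in P. s \<in> ?X -` {w \<in> space (PiM ?I cell_law). lpp w (M - 1) N < - ln a} \<inter> space P \<longleftrightarrow>
          s \<in> {s \<in> space P. a < ?L s}"
        using L_eq AE_space
      proof eventually_elim
        case (elim s)
        have "lpp (?X s) (M - 1) N = lpp (\<lambda>c. E c s) (M - 1) N"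
          by (rule lpp_cong) (use M in auto)
        moreover have "?X s \<in> space (PiM ?I cell_law)"
          by (auto simp: space_PiM cell_law_def)
        moreover have "a < exp (- l) \<longleftrightarrow> l < - ln a" for l
          using ln_less_cancel_iff[OF a exp_gt_zero[of "- l"]] by auto
        ultimately show ?case using elim by simp
      qed
    qed (use measurable_sets[OF X S] Lm in auto)
    finally show ?thesis ..
  qed
  have "rate 0 1 = \<alpha> + (\<eta> + \<theta>) / 2" unfolding rate_def by (simp add: field_simps)
  moreover have "0 < rate k n" if "k < M" "1 \<le> n" "n \<le> N" for k n
    using rate[of "(Suc k, n)"] pos[of "Suc k" n] that by simp
  ultimately show "\<exists>K. \<forall>a. 0 < a \<longrightarrow> a < 1 \<longrightarrow>
      integrable (PiM {1..M} (\<lambda>_. lborel)) (\<lambda>x. indicator {x \<in> ordered_configurations M. a < x 1} x *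
        (K * ensemble_weight M N \<alpha> \<eta> \<theta> x)) \<and>
      measure P {s \<in> space P. a < ?L s} =
      (\<integral>x. indicator {x \<in> ordered_configurations M. a < x 1} x *
        (K * ensemble_weight M N \<alpha> \<eta> \<theta> x) \<partial>PiM {1..M} (\<lambda>_. lborel))"
    using lpp_tail[OF M, of \<alpha>] tail by simp
qed

text \<open>Letting s tend to 0 in the proportional tails gives
  \<open>ennreal \<kappa> * emeasure B UNIV = 1\<close>. Thus the total mass of \<open>B\<close> is
  positive and finite, and \<kappa> is its reciprocal: finiteness of the normalising integral is a
  conclusion.\<close>

lemma tail_normalise:
  fixes A B :: "real measure"
  assumes sets: "sets A = sets borel" "sets B = sets borel" and A: "prob_space A"
    and low: "emeasure A {..0} = 0" "emeasure B {..0} = 0"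
    and high: "emeasure A {1<..} = 0" "emeasure B {1<..} = 0"
    and tail: "\<And>s. 0 < s \<Longrightarrow> s < 1 \<Longrightarrow> emeasure A {s<..} = ennreal \<kappa> * emeasure B {s<..}"
  shows "emeasure A {s<..} = emeasure B {s<..} / emeasure B UNIV"
proof -
  interpret A: prob_space A by fact
  \<comment> \<open>The shift by 2 keeps every endpoint strictly below 1, where the hypothesis on
    tails applies.\<close>
  define U where "U = (\<lambda>n. {1 / (real n + 2)<..})"
  have U: "range U \<subseteq> sets A" "range U \<subseteq> sets B" "incseq U"
    unfolding sets by (auto simp: U_def incseq_def frac_le intro: order.strict_trans1[rotated])
  have UN: "(\<Union>n. U n) = {0<..}"
  proof (intro equalityI subsetI)
    fix x :: real assume "x \<in> {0<..}"
    then obtain n where "inverse (real (Suc n)) < x" using reals_Archimedean by auto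
    moreover have "1 / (real n + 2) \<le> inverse (real (Suc n))" by (simp add: field_simps)
    ultimately show "x \<in> (\<Union>n. U n)" by (auto simp: U_def intro!: exI[of _ n])
  qed (auto simp: U_def intro: order.strict_trans[rotated])
  have split: "emeasure C UNIV = emeasure C {0<..}" if "sets C = sets borel" "emeasure C {..0} = 0" for C :: "real measure"
  proof -
    have "emeasure C {..0} + emeasure C {0<..} = emeasure C ({..0} \<union> {0<..})"
      by (rule plus_emeasure) (use that in auto)
    moreover have "{..0} \<union> {0<..} = (UNIV :: real set)" by auto
    ultimately show ?thesis using that(2) by simp
  qed
  have "emeasure A UNIV = 1" using A.emeasure_space_1 sets_eq_imp_space_eq[OF sets(1)] by simp
  then have "1 = emeasure A {0<..}" using split[OF sets(1) low(1)] by simp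
  also have "\<dots> = (SUP n. emeasure A (U n))" using SUP_emeasure_incseq[OF U(1,3)] UN by simp
  also have "\<dots> = (SUP n. ennreal \<kappa> * emeasure B (U n))"
    unfolding U_def by (intro SUP_cong refl tail) auto
  also have "\<dots> = ennreal \<kappa> * (SUP n. emeasure B (U n))" by (rule SUP_mult_left_ennreal[symmetric])
  also have "(SUP n. emeasure B (U n)) = emeasure B UNIV"
    using SUP_emeasure_incseq[OF U(2,3)] UN split[OF sets(2) low(2)] by simp
  finally have Z: "ennreal \<kappa> * emeasure B UNIV = 1" ..
  then have Z': "emeasure B UNIV \<noteq> 0" "emeasure B UNIV \<noteq> \<infinity>"
    by (auto simp: ennreal_mult_top split: if_splits)
  consider "s \<le> 0" | "0 < s" "s < 1" | "1 \<le> s" by linarith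
  then show ?thesis
  proof cases
    case 1
    have "emeasure C {s<..} = emeasure C UNIV" if "sets C = sets borel" "emeasure C {..0} = 0" for C :: "real measure"
    proof (rule antisym)
      have "emeasure C {0<..} \<le> emeasure C {s<..}" by (rule emeasure_mono) (use 1 that in auto)
      then show "emeasure C UNIV \<le> emeasure C {s<..}" using split[OF that] by simp
    qed (rule emeasure_mono, use that in auto)
    then show ?thesis
      using sets low Z' \<open>emeasure A UNIV = 1\<close> by (simp add: ennreal_divide_self less_top)
  next
    case 2
    have "emeasure B {s<..} / emeasure B UNIV = ennreal \<kappa> * emeasure B {s<..} * emeasure B UNIV / emeasure B UNIV"
      using Z by (simp add: mult.assoc mult.left_commute[of "ennreal \<kappa>"])
    then show ?thesis using tail[OF 2] Z' by (simp add: ennreal_mult_divide_eq)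
  next
    case 3
    have "emeasure C {s<..} = 0" if "sets C = sets borel" "emeasure C {1<..} = 0" for C :: "real measure"
      using emeasure_mono[of "{s<..}" "{1<..}" C] 3 that by auto
    then show ?thesis using sets high by simp
  qed
qed

section \<open>Positivity, measurability and identification of the ensemble law\<close>

lemma power_difference_nonneg:
  assumes "0 \<le> s" "0 < a" "a \<le> b"
  shows "0 \<le> power_difference s a b"
  using assms powr_mono2[of s a b] by (auto simp: power_difference_def)

lemma ensemble_weight_nonneg:
  assumes "0 \<le> \<eta>" "0 \<le> \<theta>" "x \<in> ordered_configurations M"
  shows "0 \<le> ensemble_weight M N \<alpha> \<eta> \<theta> x"
proof -
  have x: "0 < x i" "x i < 1" if "i \<in> {1..M}" for i
    using assms(3) that by (auto simp: ordered_configurations_def PiE_iff)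
  have "x i \<le> x j" if "i \<in> {1..<j}" "j \<in> {1..M}" for i j
    using assms(3) that strict_mono_onD[of "{1..M}" x i j] by (auto simp: ordered_configurations_def)
  then show ?thesis
    unfolding ensemble_weight_def using x assms(1,2)
    by (intro mult_nonneg_nonneg prod_nonneg ballI power_difference_nonneg zero_le_power powr_ge_zero)
       (auto intro: less_imp_le)
qed

lemma measurable_ensemble_density [measurable]:
  "ensemble_density M N \<alpha> \<eta> \<theta> \<in> borel_measurable (PiM {1..M} (\<lambda>_. lborel))"
proof -
  let ?L = "PiM {1..M} (\<lambda>_. lborel :: real measure)"
  have comp: "(\<lambda>x. x i) \<in> borel_measurable ?L" if "i \<in> {1..M}" for i
    using measurable_component_singleton[OF that, of "\<lambda>_. lborel :: real measure"] by simp
  have pd: "(\<lambda>x. power_difference s (f x) (g x)) \<in> borel_measurable ?L"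
    if [measurable]: "f \<in> borel_measurable ?L" "g \<in> borel_measurable ?L" for s f g
    unfolding power_difference_def by measurable
  have w: "ensemble_weight M N \<alpha> \<eta> \<theta> \<in> borel_measurable ?L"
    unfolding ensemble_weight_def[abs_def]
    by (intro borel_measurable_times borel_measurable_prod borel_measurable_power pd comp
        powr_real_measurable borel_measurable_const) auto
  have mono: "{x \<in> space ?L. strict_mono_on {1..M} x} \<in> sets ?L"
    using measurable_strict_mono_on[of "{1..M}" "\<lambda>_. lborel"] by (simp add: pred_def)
  have box: "{x \<in> space ?L. \<forall>i\<in>{1..M}. 0 < x i \<and> x i < 1} \<in> sets ?L"
    by (intro sets.sets_Collect_finite_All sets.sets_Collect_conj borel_measurable_less
        borel_measurable_const comp) auto
  have "ordered_configurations M =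
      {x \<in> space ?L. strict_mono_on {1..M} x} \<inter> {x \<in> space ?L. \<forall>i\<in>{1..M}. 0 < x i \<and> x i < 1}"
    by (auto simp: ordered_configurations_def space_PiM PiE_iff)
  then have "ordered_configurations M \<in> sets ?L" using mono box by (simp only: sets.Int)
  then show ?thesis
    unfolding ensemble_density_def[abs_def] using w by measurable
qed

text \<open>\<open>B\<close>, the image of the unnormalised density under the first coordinate, has
  tails proportional to those of \<open>X\<close>. Both live on (0, 1], so
  \<open>tail_normalise\<close> determines the factor, and the tails determine the law.\<close>

lemma distr_eq_ensemble:
  assumes P: "prob_space P" and X: "X \<in> borel_measurable P" and AE: "AE s in P. 0 < X s \<and> X s \<le> 1"
    and M: "1 \<le> M" and nonneg: "0 \<le> \<eta>" "0 \<le> \<theta>"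
    and tail: "\<And>a. 0 < a \<Longrightarrow> a < 1 \<Longrightarrow>
      integrable (PiM {1..M} (\<lambda>_. lborel)) (\<lambda>x. indicator {x \<in> ordered_configurations M. a < x 1} x *
        (K * ensemble_weight M N \<alpha> \<eta> \<theta> x)) \<and>
      measure P {s \<in> space P. a < X s} =
      (\<integral>x. indicator {x \<in> ordered_configurations M. a < x 1} x *
        (K * ensemble_weight M N \<alpha> \<eta> \<theta> x) \<partial>PiM {1..M} (\<lambda>_. lborel))"
  shows "distr P borel X = distr (ensemble M N \<alpha> \<eta> \<theta>) borel (\<lambda>x. x 1)"
proof -
  interpret prob_space P by fact
  let ?L = "PiM {1..M} (\<lambda>_. lborel :: real measure)"
  let ?d = "ensemble_density M N \<alpha> \<eta> \<theta>" and ?w = "ensemble_weight M N \<alpha> \<eta> \<theta>"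
  define B where "B = distr (density ?L ?d) borel (\<lambda>x. x 1)"
  have x1: "(\<lambda>x. x 1) \<in> borel_measurable ?L"
    using measurable_component_singleton[of 1 "{1..M}" "\<lambda>_. lborel :: real measure"] M by simp
  have sets_B: "sets B = sets borel" by (simp add: B_def)
  have dS: "(\<lambda>x. ?d x * indicator S (x 1)) \<in> borel_measurable ?L" if "S \<in> sets borel" for S
    by (intro borel_measurable_times_ennreal measurable_ensemble_density
        measurable_compose[OF x1 borel_measurable_indicator[OF that]])
  have B: "emeasure B S = (\<integral>\<^sup>+x. ?d x * indicator S (x 1) \<partial>?L)" if [measurable]: "S \<in> sets borel" for S
  proof -
    have "emeasure B S = emeasure (density ?L ?d) ((\<lambda>x. x 1) -` S \<inter> space ?L)"
      unfolding B_def using x1 by (subst emeasure_distr) auto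
    also have "\<dots> = (\<integral>\<^sup>+x. ?d x * indicator ((\<lambda>x. x 1) -` S \<inter> space ?L) x \<partial>?L)"
      using x1 by (intro emeasure_density measurable_sets[OF x1 that] measurable_ensemble_density)
    also have "\<dots> = (\<integral>\<^sup>+x. ?d x * indicator S (x 1) \<partial>?L)"
      by (intro nn_integral_cong) (auto simp: indicator_def)
    finally show ?thesis .
  qed
  have range: "0 < x 1 \<and> x 1 < 1" if "x \<in> ordered_configurations M" for x
    using that M by (auto simp: ordered_configurations_def PiE_iff)
  have B0: "emeasure B S = 0" if S: "S \<in> sets borel" "S \<inter> {0<..<1} = {}" for S
  proof -
    have zero: "?d x * indicator S (x 1) = 0" for x
      using range[of x] S(2) by (auto simp: ensemble_density_def indicator_def)
    show ?thesis unfolding B[OF S(1)] zero by simp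
  qed
  \<comment> \<open>The sign of \<open>K\<close> is forced: since the weight is nonnegative,
    \<open>K \<le> 0\<close> would make all tails of \<open>X\<close> at levels in (0, 1) vanish,
    against \<open>X\<close> being positive almost surely.\<close>
  have K: "0 < K"
  proof (rule ccontr)
    assume "\<not> 0 < K"
    then have K: "K \<le> 0" by simp
    have zero: "measure P {s \<in> space P. a < X s} = 0" if "0 < a" "a < 1" for a
    proof (rule antisym)
      have "indicator {x \<in> ordered_configurations M. a < x 1} x * (K * ?w x) \<le> 0" for x
        using K ensemble_weight_nonneg[OF nonneg, of x M N \<alpha>]
        by (auto simp: indicator_def mult_nonpos_nonneg)
      then have "(\<integral>x. indicator {x \<in> ordered_configurations M. a < x 1} x * (K * ?w x) \<partial>?L) \<le> (\<integral>x. 0 \<partial>?L)"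
        by (intro integral_mono_AE) (use tail[OF that] in auto)
      then show "measure P {s \<in> space P. a < X s} \<le> 0" using tail[OF that] by simp
    qed simp
    have "AE s in P. \<forall>n. \<not> 1 / (real n + 2) < X s"
      unfolding AE_all_countable
    proof
      fix n
      have "emeasure P {s \<in> space P. 1 / (real n + 2) < X s} = 0"
        using zero[of "1 / (real n + 2)"] by (simp add: emeasure_eq_measure)
      then show "AE s in P. \<not> 1 / (real n + 2) < X s"
        using X by (subst AE_iff_measurable[OF _ refl]) (auto intro: borel_measurable_less)
    qed
    with AE have "AE s in P. False"
    proof eventually_elim
      case (elim s)
      then obtain n where "inverse (real (Suc n)) < X s" using reals_Archimedean by blast
      moreover have "1 / (real n + 2) \<le> inverse (real (Suc n))" by (simp add: field_simps)
      ultimately show ?case using elim by (meson le_less_trans)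
    qed
    then show False by simp
  qed
  have B_tail: "emeasure (distr P borel X) {a<..} = ennreal K * emeasure B {a<..}" if a: "0 < a" "a < 1" for a
  proof -
    let ?i = "\<lambda>x. indicator {x \<in> ordered_configurations M. a < x 1} x :: real"
    have nn: "0 \<le> ?i x * (K * ?w x)" for x
      using K ensemble_weight_nonneg[OF nonneg, of x M N \<alpha>] by (auto simp: indicator_def)
    have "emeasure (distr P borel X) {a<..} = emeasure P {s \<in> space P. a < X s}"
      using X by (subst emeasure_distr) (auto intro!: arg_cong[where f = "emeasure P"])
    also have "\<dots> = ennreal (\<integral>x. ?i x * (K * ?w x) \<partial>?L)"
      using tail[OF a] by (simp add: emeasure_eq_measure)
    also have "\<dots> = (\<integral>\<^sup>+x. ennreal (?i x * (K * ?w x)) \<partial>?L)"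
      using tail[OF a] nn by (intro nn_integral_eq_integral[symmetric]) auto
    also have "\<dots> = (\<integral>\<^sup>+x. ennreal K * (?d x * indicator {a<..} (x 1)) \<partial>?L)"
      using K by (intro nn_integral_cong) (auto simp: ensemble_density_def indicator_def ennreal_mult')
    also have "\<dots> = ennreal K * emeasure B {a<..}"
      using nn_integral_cmult[OF dS[of "{a<..}"]] B[of "{a<..}"] by (simp only: borel_open open_greaterThan)
    finally show ?thesis .
  qed
  have A: "prob_space (distr P borel X)" by (rule prob_space_distr[OF X])
  have A0: "emeasure (distr P borel X) S = 0" if "S \<in> sets borel" "S \<inter> {0<..1} = {}" for S
  proof -
    have "AE s in P. s \<notin> X -` S \<inter> space P" using AE by eventually_elim (use that in auto)
    then show ?thesis
      using that X by (subst emeasure_distr) (auto simp: AE_iff_null_sets null_setsD1)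
  qed
  show ?thesis
  proof (rule measure_eqI_lessThan)
    fix a :: real
    have tail_eq: "emeasure (distr P borel X) {a<..} = emeasure B {a<..} / emeasure B UNIV"
      by (rule tail_normalise[OF _ sets_B A]) (auto intro!: A0 B0 B_tail)
    have "emeasure (distr (ensemble M N \<alpha> \<eta> \<theta>) borel (\<lambda>x. x 1)) {a<..} =
        emeasure (ensemble M N \<alpha> \<eta> \<theta>) ((\<lambda>x. x 1) -` {a<..} \<inter> space ?L)"
      using x1 by (subst emeasure_distr) (auto simp: ensemble_def)
    also have "\<dots> = (\<integral>\<^sup>+x. ?d x / emeasure B UNIV * indicator ((\<lambda>x. x 1) -` {a<..} \<inter> space ?L) x \<partial>?L)"
    proof -
      have "ensemble M N \<alpha> \<eta> \<theta> = density ?L (\<lambda>x. ?d x / emeasure B UNIV)"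
        unfolding ensemble_def by (simp add: B)
      moreover have "(\<lambda>x. ?d x / emeasure B UNIV) \<in> borel_measurable ?L" by measurable
      moreover have "(\<lambda>x. x 1) -` {a<..} \<inter> space ?L \<in> sets ?L" by (rule measurable_sets[OF x1]) simp
      ultimately show ?thesis by (simp only: emeasure_density)
    qed
    also have "\<dots> = (\<integral>\<^sup>+x. ?d x * indicator {a<..} (x 1) / emeasure B UNIV \<partial>?L)"
      by (intro nn_integral_cong) (auto simp: indicator_def)
    also have "\<dots> = emeasure B {a<..} / emeasure B UNIV"
      using nn_integral_divide[OF dS[of "{a<..}"]] B[of "{a<..}"] by (simp only: borel_open open_greaterThan)
    finally show "emeasure (distr P borel X) {a<..} =
        emeasure (distr (ensemble M N \<alpha> \<eta> \<theta>) borel (\<lambda>x. x 1)) {a<..}"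
      using tail_eq by simp
    interpret A: prob_space "distr P borel X" by (rule A)
    show "emeasure (distr P borel X) {a<..} < \<infinity>" by (simp add: A.emeasure_eq_measure)
  qed simp_all
qed

text \<open>Each index belongs to exactly M - 1 pairs.\<close>

lemma prod_pairs: "(\<Prod>j\<in>{1..M}. \<Prod>i\<in>{1..<j}. f i * f j :: real) = (\<Prod>j\<in>{1..M}. f j ^ (M - 1))"
proof (induction M)
  case (Suc M)
  have "(\<Prod>j\<in>{1..Suc M}. \<Prod>i\<in>{1..<j}. f i * f j) =
      (\<Prod>j\<in>{1..M}. f j ^ (M - 1)) * ((\<Prod>i\<in>{1..M}. f i) * f (Suc M) ^ M)"
    using Suc by (simp add: prod.distrib atLeastLessThanSuc_atLeastAtMost)
  also have "(\<Prod>j\<in>{1..M}. f j ^ (M - 1)) * ((\<Prod>i\<in>{1..M}. f i) * f (Suc M) ^ M) =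
      (\<Prod>j\<in>{1..M}. f j ^ (M - 1) * f j) * f (Suc M) ^ M"
    by (simp add: prod.distrib)
  also have "(\<Prod>j\<in>{1..M}. f j ^ (M - 1) * f j) = (\<Prod>j\<in>{1..M}. f j ^ M)"
    by (intro prod.cong refl) (auto simp: power_Suc2[symmetric])
  finally show ?case by simp
qed simp

text \<open>Negating \<open>\<eta>\<close> multiplies each factor \<open>x\<^sub>j\<^sup>\<eta> - x\<^sub>i\<^sup>\<eta>\<close> by \<open>- (x\<^sub>i x\<^sub>j)\<^sup>-\<^sup>\<eta>\<close>; the shift of \<open>\<alpha>\<close> absorbs the powers.\<close>

lemma ensemble_weight_reflect:
  assumes M: "1 \<le> M"
  shows "\<exists>\<epsilon>. \<forall>x. (\<forall>i\<in>{1..M}. 0 < x i) \<longrightarrow>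
    ensemble_weight M N (\<alpha> + \<eta> * real M) (- \<eta>) \<theta> x = \<epsilon> * ensemble_weight M N \<alpha> \<eta> \<theta> x"
proof (cases "\<eta> = 0")
  case True
  then show ?thesis by (intro exI[of _ 1]) simp
next
  case False
  let ?V = "\<lambda>s x. \<Prod>j\<in>{1..M}. \<Prod>i\<in>{1..<j}. power_difference s (x i) (x j)"
  define \<epsilon> where "\<epsilon> = (\<Prod>j\<in>{1..M}. \<Prod>i\<in>{1..<j}. - 1 :: real)"
  have "ensemble_weight M N (\<alpha> + \<eta> * real M) (- \<eta>) \<theta> x = \<epsilon> * ensemble_weight M N \<alpha> \<eta> \<theta> x"
    if x: "\<forall>i\<in>{1..M}. 0 < x i" for x
  proof -
    have "?V (- \<eta>) x = (\<Prod>j\<in>{1..M}. \<Prod>i\<in>{1..<j}. - 1 *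
        ((x i powr - \<eta> * x j powr - \<eta>) * power_difference \<eta> (x i) (x j)))"
    proof (intro prod.cong refl)
      fix i j assume "j \<in> {1..M}" "i \<in> {1..<j}"
      then have "0 < x i" "0 < x j" using x by auto
      then show "power_difference (- \<eta>) (x i) (x j) =
          - 1 * ((x i powr - \<eta> * x j powr - \<eta>) * power_difference \<eta> (x i) (x j))"
        using False by (simp add: power_difference_def powr_minus field_simps)
    qed
    also have "\<dots> = \<epsilon> * ((\<Prod>j\<in>{1..M}. \<Prod>i\<in>{1..<j}. x i powr - \<eta> * x j powr - \<eta>) * ?V \<eta> x)"
      unfolding \<epsilon>_def by (simp only: prod.distrib)
    also have "(\<Prod>j\<in>{1..M}. \<Prod>i\<in>{1..<j}. x i powr - \<eta> * x j powr - \<eta>) =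
        (\<Prod>j\<in>{1..M}. (x j powr - \<eta>) ^ (M - 1))"
      by (rule prod_pairs)
    finally have V: "?V (- \<eta>) x = \<epsilon> * ((\<Prod>j\<in>{1..M}. (x j powr - \<eta>) ^ (M - 1)) * ?V \<eta> x)" .
    have R: "(\<Prod>j\<in>{1..M}. (x j powr - \<eta>) ^ (M - 1)) *
        (\<Prod>j\<in>{1..M}. x j powr (\<alpha> + \<eta> * real M + (- \<eta> + \<theta>) / 2 - 1) * power_difference \<theta> (x j) 1 ^ (N - M)) =
        (\<Prod>j\<in>{1..M}. x j powr (\<alpha> + (\<eta> + \<theta>) / 2 - 1) * power_difference \<theta> (x j) 1 ^ (N - M))"
      unfolding prod.distrib[symmetric]
    proof (intro prod.cong refl)
      fix j assume "j \<in> {1..M}"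
      then have xj: "0 < x j" using x by auto
      \<comment> \<open>The exponents balance:
        \<open>- \<eta> * (M - 1) + \<eta> * M - \<eta> / 2 = \<eta> / 2\<close>. This is where the
        shift of \<alpha> by \<open>\<eta> * M\<close> comes from.\<close>
      have "(x j powr - \<eta>) ^ (M - 1) = x j powr (- \<eta> * (real M - 1))"
        using xj M by (simp add: powr_realpow[symmetric] powr_powr of_nat_diff)
      then have "(x j powr - \<eta>) ^ (M - 1) * x j powr (\<alpha> + \<eta> * real M + (- \<eta> + \<theta>) / 2 - 1) =
          x j powr (\<alpha> + (\<eta> + \<theta>) / 2 - 1)"
        by (simp add: powr_add[symmetric] algebra_simps add_divide_distrib diff_divide_distrib)
      then show "(x j powr - \<eta>) ^ (M - 1) * (x j powr (\<alpha> + \<eta> * real M + (- \<eta> + \<theta>) / 2 - 1) *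
          power_difference \<theta> (x j) 1 ^ (N - M)) =
          x j powr (\<alpha> + (\<eta> + \<theta>) / 2 - 1) * power_difference \<theta> (x j) 1 ^ (N - M)"
        by (simp only: mult.assoc[symmetric])
    qed
    have split: "ensemble_weight M N a e \<theta> x = ?V e x * ?V \<theta> x *
        (\<Prod>j\<in>{1..M}. x j powr (a + (e + \<theta>) / 2 - 1) * power_difference \<theta> (x j) 1 ^ (N - M))" for a e
      unfolding ensemble_weight_def by (simp only: prod.distrib)
    show ?thesis unfolding split V R[symmetric] by (simp only: mult_ac)
  qed
  then show ?thesis by blast
qed

theorem theorem3:
  fixes M N :: nat and \<alpha> \<eta> \<theta> :: real
    and P :: "'a measure" and \<omega> :: "nat \<times> nat \<Rightarrow> 'a \<Rightarrow> real"
  assumes "1 \<le> M" and "M \<le> N"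
    and "0 \<le> \<alpha>" and "0 \<le> \<eta>" and "0 \<le> \<theta>"
    and "\<not> (\<alpha> = 0 \<and> \<eta> = 0 \<and> \<theta> = 0)"
    and "prob_space P"
    and "prob_space.indep_vars P (\<lambda>_. borel) \<omega> ({1..M} \<times> {1..N})"
    and "\<And>i j. i \<in> {1..M} \<Longrightarrow> j \<in> {1..N} \<Longrightarrow>
      distributed P lborel (\<omega> (i, j))
        (pow_density (\<alpha> + \<eta> * (real i - 1 / 2) + \<theta> * (real j - 1 / 2)))"
  shows "distr P borel (\<lambda>s. L1 M N (\<lambda>c. \<omega> c s)) = distr P borel (\<lambda>s. L2 M N (\<lambda>c. \<omega> c s)) \<and>
    distr P borel (\<lambda>s. L1 M N (\<lambda>c. \<omega> c s)) = distr (ensemble M N \<alpha> \<eta> \<theta>) borel (\<lambda>x. x 1)"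
proof -
  interpret prob_space P by fact
  have pos: "0 < \<alpha> + \<eta> * (real i - 1 / 2) + \<theta> * (real j - 1 / 2)" if "i \<in> {1..M}" "j \<in> {1..N}" for i j
  proof -
    \<comment> \<open>Every rate is at least that of cell (1, 1), which is positive because the
      parameters do not all vanish.\<close>
    have "1 / 2 \<le> real i - 1 / 2" "1 / 2 \<le> real j - 1 / 2" using that by auto
    then have "\<eta> * (1 / 2) \<le> \<eta> * (real i - 1 / 2)" "\<theta> * (1 / 2) \<le> \<theta> * (real j - 1 / 2)"
      using assms(4,5) by (intro mult_left_mono; simp)+
    moreover have "0 < \<alpha> + \<eta> * (1 / 2) + \<theta> * (1 / 2)"
      using assms(3-6) by (cases "\<eta> = 0"; cases "\<theta> = 0") (auto intro: add_nonneg_pos add_pos_nonneg)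
    ultimately show ?thesis by linarith
  qed
  note T1 = L1_tail[OF assms(1,2,7,8) pos assms(9)]
  obtain K1 where K1: "\<And>a. 0 < a \<Longrightarrow> a < 1 \<Longrightarrow>
      integrable (PiM {1..M} (\<lambda>_. lborel)) (\<lambda>x. indicator {x \<in> ordered_configurations M. a < x 1} x *
        (K1 * ensemble_weight M N \<alpha> \<eta> \<theta> x)) \<and>
      measure P {s \<in> space P. a < L1 M N (\<lambda>c. \<omega> c s)} =
      (\<integral>x. indicator {x \<in> ordered_configurations M. a < x 1} x *
        (K1 * ensemble_weight M N \<alpha> \<eta> \<theta> x) \<partial>PiM {1..M} (\<lambda>_. lborel))"
    using T1(3) by blast
  have D1: "distr P borel (\<lambda>s. L1 M N (\<lambda>c. \<omega> c s)) = distr (ensemble M N \<alpha> \<eta> \<theta>) borel (\<lambda>x. x 1)"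
    by (rule distr_eq_ensemble[OF assms(7) T1(1,2) assms(1,4,5) K1])
  define \<phi> where "\<phi> = (\<lambda>c :: cell. (M + 1 - fst c, snd c))"
  define \<omega>' where "\<omega>' = (\<lambda>c. \<omega> (\<phi> c))"
  have L2: "L2 M N (\<lambda>c. \<omega> c s) = L1 M N (\<lambda>c. \<omega>' c s)" for s
    unfolding L2_eq_L1_reflected \<omega>'_def \<phi>_def ..
  have inj: "inj_on \<phi> ({1..M} \<times> {1..N})"
    by (rule inj_on_inverseI[where g = \<phi>]) (auto simp: \<phi>_def)
  have image: "\<phi> ` ({1..M} \<times> {1..N}) \<subseteq> {1..M} \<times> {1..N}"
    by (auto simp: \<phi>_def)
  have ind: "indep_vars (\<lambda>_. borel) \<omega>' ({1..M} \<times> {1..N})"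
    unfolding \<omega>'_def by (rule indep_vars_reindex[OF assms(8) inj image])
  \<comment> \<open>Row i of the reversed array is row M + 1 - i of the original, and
    \<open>M + 1 - i - 1 / 2 = M - (i - 1 / 2)\<close>: the progression runs backwards from
    \<open>\<alpha> + \<eta> * M\<close>.\<close>
  have rate: "\<alpha> + \<eta> * real M + - \<eta> * (real i - 1 / 2) + \<theta> * (real j - 1 / 2) =
      \<alpha> + \<eta> * (real (M + 1 - i) - 1 / 2) + \<theta> * (real j - 1 / 2)" if "i \<in> {1..M}" for i j
    using that by (simp add: of_nat_diff algebra_simps)
  have pos': "0 < \<alpha> + \<eta> * real M + - \<eta> * (real i - 1 / 2) + \<theta> * (real j - 1 / 2)"
    if "i \<in> {1..M}" "j \<in> {1..N}" for i j
    unfolding rate[OF that(1)] by (rule pos) (use that in auto)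
  have d': "distributed P lborel (\<omega>' (i, j))
      (pow_density (\<alpha> + \<eta> * real M + - \<eta> * (real i - 1 / 2) + \<theta> * (real j - 1 / 2)))"
    if "i \<in> {1..M}" "j \<in> {1..N}" for i j
    unfolding rate[OF that(1)] \<omega>'_def \<phi>_def fst_conv snd_conv by (rule assms(9)) (use that in auto)
  note T2 = L1_tail[OF assms(1,2,7) ind pos' d']
  obtain K2 where K2: "\<And>a. 0 < a \<Longrightarrow> a < 1 \<Longrightarrow>
      integrable (PiM {1..M} (\<lambda>_. lborel)) (\<lambda>x. indicator {x \<in> ordered_configurations M. a < x 1} x *
        (K2 * ensemble_weight M N (\<alpha> + \<eta> * real M) (- \<eta>) \<theta> x)) \<and>
      measure P {s \<in> space P. a < L1 M N (\<lambda>c. \<omega>' c s)} =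
      (\<integral>x. indicator {x \<in> ordered_configurations M. a < x 1} x *
        (K2 * ensemble_weight M N (\<alpha> + \<eta> * real M) (- \<eta>) \<theta> x) \<partial>PiM {1..M} (\<lambda>_. lborel))"
    using T2(3) by blast
  obtain \<epsilon> where \<epsilon>: "\<And>x. \<forall>i\<in>{1..M}. 0 < x i \<Longrightarrow>
      ensemble_weight M N (\<alpha> + \<eta> * real M) (- \<eta>) \<theta> x = \<epsilon> * ensemble_weight M N \<alpha> \<eta> \<theta> x"
    using ensemble_weight_reflect[OF assms(1), of N \<alpha> \<eta> \<theta>] by blast
  \<comment> \<open>Absorbing \<epsilon> into the constant returns to the weight with the original
    \<eta>, for which \<open>distr_eq_ensemble\<close> has the nonnegativity it requires.\<close>
  have eq: "(\<lambda>x. indicator {x \<in> ordered_configurations M. a < x 1} x *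
        (K2 * ensemble_weight M N (\<alpha> + \<eta> * real M) (- \<eta>) \<theta> x)) =
      (\<lambda>x. indicator {x \<in> ordered_configurations M. a < x 1} x *
        (K2 * \<epsilon> * ensemble_weight M N \<alpha> \<eta> \<theta> x))" for a :: real
    by (rule ext) (auto simp: indicator_def ordered_configurations_def PiE_iff \<epsilon>)
  have "distr P borel (\<lambda>s. L1 M N (\<lambda>c. \<omega>' c s)) = distr (ensemble M N \<alpha> \<eta> \<theta>) borel (\<lambda>x. x 1)"
    by (rule distr_eq_ensemble[OF assms(7) T2(1,2) assms(1,4,5) K2[unfolded eq]])
  then show ?thesis using D1 unfolding L2 by simp
qed

end
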